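(* Let $G$ be a well-partitioned chordal graph. Then $G$ is a comparability graph if and only if $G$ contains none of the graphs $W_1,W_2,W_3,W_4$ as an induced subgraph, where: $W_1$ has vertices $1,\dots,6$ and edges $13,24,34,35,45,56$; $W_2$ has vertices $1,\dots,6$ and edges $12,23,14,24,25,35,45,46,56$; $W_3$ has vertices $1,\dots,7$ and edges $13,24,34,35,45,36,56,47,57$; $W_4$ has vertices $1,\dots,7$ and edges $12,13,14,15,23,24,35,46,57$.
   Context: All graphs are finite, simple and connected. A comparability graph is a graph admitting a transitive orientation. A connected graph $G=(V,E)$ is a well-partitioned chordal graph if there exist a partition $\mathcal{P}$ of $V$ and a tree $\mathcal{T}$ with vertex set $\mathcal{P}$ such that: (1) each part is a clique of $G$; (2) for every edge $AB$ of $\mathcal{T}$ there exist $A'\subseteq A$, $B'\subseteq B$ such that the edges of $G$ between $A$ and $B$ are exactly the pairs in $A'\times B'$; (3) for distinct parts $A,B$ not adjacent in $\mathcal{T}$ there are no edges of $G$ between $A$ and $B$. *)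

theory Defs
  imports "Graph_Theory.Graph_Theory" "HOL-Library.Disjoint_Sets"
begin

text \<open>
  A finite simple graph is a \<open>pair_graph\<close>: a finite loopfree digraph without parallel arcs
  whose arc set is symmetric, an edge \<open>uv\<close> being the two arcs \<open>(u, v)\<close> and \<open>(v, u)\<close>.
\<close>

text \<open>
  The library's \<open>tree\<close> cannot be used: it forbids every directed cycle, and in a symmetric digraph
  each edge \<open>uv\<close> yields the directed cycle \<open>u, v, u\<close>.  The cycles of the undirected graph are
  the directed cycles of length at least 3.
\<close>

definition undirected_tree :: "'a pair_pre_digraph \<Rightarrow> bool" where
  "undirected_tree T \<longleftrightarrow> pair_graph T \<and> connected T \<and>
     \<not> (\<exists>p. pre_digraph.cycle T p \<and> 3 \<le> length p)"

definition clique :: "'a pair_pre_digraph \<Rightarrow> 'a set \<Rightarrow> bool" where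
  "clique G C \<longleftrightarrow> C \<subseteq> pverts G \<and> (\<forall>u\<in>C. \<forall>v\<in>C. u \<noteq> v \<longrightarrow> (u, v) \<in> parcs G)"

definition transitive_orientation :: "'a pair_pre_digraph \<Rightarrow> 'a rel \<Rightarrow> bool" where
  "transitive_orientation G F \<longleftrightarrow> F \<union> F\<inverse> = parcs G \<and> F \<inter> F\<inverse> = {} \<and> trans F"

definition comparability_graph :: "'a pair_pre_digraph \<Rightarrow> bool" where
  "comparability_graph G \<longleftrightarrow> pair_graph G \<and> (\<exists>F. transitive_orientation G F)"

definition well_partitioned_chordal :: "'a pair_pre_digraph \<Rightarrow> bool" where
  "well_partitioned_chordal G \<longleftrightarrow> pair_graph G \<and> connected G \<and>
     (\<exists>P T. partition_on (pverts G) P \<and> undirected_tree T \<and> pverts T = P \<and>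
        (\<forall>A\<in>P. clique G A) \<and>
        (\<forall>A B. (A, B) \<in> parcs T \<longrightarrow>
           (\<exists>A' B'. A' \<subseteq> A \<and> B' \<subseteq> B \<and> parcs G \<inter> (A \<times> B) = A' \<times> B')) \<and>
        (\<forall>A\<in>P. \<forall>B\<in>P. A \<noteq> B \<and> (A, B) \<notin> parcs T \<longrightarrow> parcs G \<inter> (A \<times> B) = {}))"

definition contains_induced :: "'a pair_pre_digraph \<Rightarrow> 'b pair_pre_digraph \<Rightarrow> bool" where
  "contains_induced G W \<longleftrightarrow> (\<exists>H. induced_subgraph H (with_proj G) \<and> digraph_iso H (with_proj W))"

definition undirected_graph :: "'a set \<Rightarrow> ('a \<times> 'a) set \<Rightarrow> 'a pair_pre_digraph" where
  "undirected_graph V E = \<lparr> pverts = V, parcs = E \<union> E\<inverse> \<rparr>"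

definition W1 :: "nat pair_pre_digraph" where
  "W1 = undirected_graph {1..6} {(1,3), (2,4), (3,4), (3,5), (4,5), (5,6)}"

definition W2 :: "nat pair_pre_digraph" where
  "W2 = undirected_graph {1..6}
     {(1,2), (2,3), (1,4), (2,4), (2,5), (3,5), (4,5), (4,6), (5,6)}"

definition W3 :: "nat pair_pre_digraph" where
  "W3 = undirected_graph {1..7}
     {(1,3), (2,4), (3,4), (3,5), (4,5), (3,6), (5,6), (4,7), (5,7)}"

definition W4 :: "nat pair_pre_digraph" where
  "W4 = undirected_graph {1..7}
     {(1,2), (1,3), (1,4), (1,5), (2,3), (2,4), (3,5), (4,6), (5,7)}"

end

theory Submission
  imports Defs
begin

text \<open>
  Each \<open>W\<^sub>i\<close> fails to be a comparability graph because an induced path \<open>x, y, z\<close> forces \<open>xy\<close> and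
  \<open>zy\<close> to be both directed towards \<open>y\<close> or both away from \<open>y\<close>.

  Conversely, call the parts of the partition bags. A vertex is to be a source (sign \<open>1\<close>) or a sink
  (sign \<open>-1\<close>) with respect to its neighbours outside its bag; only bags that are modules attached to
  a single other bag may have sign \<open>0\<close>, since their vertices need be neither. If adjacent vertices of
  distinct bags have distinct signs and vertices of equal sign in a bag have comparable
  neighbourhoods, then ordering the vertices by decreasing \<open>sign \<sqdot> (|N[v]| + 1)\<close> yields a transitive
  orientation. Inside one bag, excluding \<open>W\<^sub>1, W\<^sub>2, W\<^sub>3\<close> makes the neighbourhoods an order of width at
  most two, hence a union of two chains, which are the two sign classes. The attachment set of a
  neighbouring bag without sign \<open>0\<close> must have constant sign; such sets are chains by \<open>W\<^sub>1\<close> and laminar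
  by \<open>W\<^sub>4\<close>, so the colouring can be chosen constant on them. As the bags form a tree, flipping the
  signs bag by bag makes them opposite across all edges between bags.
\<close>

section \<open>Induced copies of the forbidden graphs\<close>

lemma pair_wf_undirected_graph:
  assumes "E \<subseteq> V \<times> V"
  shows "pair_wf_digraph (undirected_graph V E)"
  using assms by unfold_locales (auto simp: undirected_graph_def)

text \<open>The arcs on both sides are pairs with ends \<open>fst\<close> and \<open>snd\<close>, so
  the arc map of an isomorphism is determined by its vertex map. What remains is an embedding of
  vertices that preserves and reflects adjacency.\<close>

lemma contains_induced_iff:
  assumes "pair_wf_digraph G" "pair_wf_digraph W"
  shows "contains_induced G W \<longleftrightarrow>
    (\<exists>f. inj_on f (pverts W) \<and> f ` pverts W \<subseteq> pverts G \<and>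
      (\<forall>i\<in>pverts W. \<forall>j\<in>pverts W. (f i, f j) \<in> parcs G \<longleftrightarrow> (i, j) \<in> parcs W))"
  (is "?L \<longleftrightarrow> ?R")
proof
  interpret W: pair_wf_digraph W by fact
  assume ?L
  then obtain H where ind: "induced_subgraph H (with_proj G)" and "digraph_iso H (with_proj W)"
    by (auto simp: contains_induced_def)
  then have "digraph_iso (with_proj W) H"
    using digraph_iso_swap[OF wf_digraphI_induced] by blast
  then obtain g where g: "pre_digraph.digraph_isomorphism (with_proj W) g"
    and H: "H = app_iso g (with_proj W)"
    by (auto simp: digraph_iso_def)
  define f where "f = iso_verts g"
  have comp: "tail H = fst" "head H = snd"
    using ind by (simp_all add: induced_subgraph_def subgraph_def compatible_def)
  have inj: "inj_on f (pverts W)"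
    using g by (auto simp: f_def pre_digraph.digraph_isomorphism_def)
  have verts: "verts H = f ` pverts W"
    by (simp add: H f_def)
  \<comment> \<open>The isomorphism commutes with heads and tails, which in \<open>H\<close> are the
    components of a pair.\<close>
  have garc: "iso_arcs g (i, j) = (f i, f j)" if "(i, j) \<in> parcs W" for i j
  proof -
    have "fst (iso_arcs g (i, j)) = f i" "snd (iso_arcs g (i, j)) = f j"
      using g that comp unfolding f_def H pre_digraph.digraph_isomorphism_def by fastforce+
    then show ?thesis by (simp add: prod_eq_iff)
  qed
  have arcs: "arcs H = (\<lambda>(i, j). (f i, f j)) ` parcs W"
    unfolding H app_iso_simps with_proj_simps using garc by (intro image_cong) auto
  have arcs': "arcs H = {e \<in> parcs G. fst e \<in> verts H \<and> snd e \<in> verts H}"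
    using ind by (auto simp: induced_subgraph_def)
  have "(f i, f j) \<in> parcs G \<longleftrightarrow> (i, j) \<in> parcs W" if "i \<in> pverts W" "j \<in> pverts W" for i j
  proof -
    have "(f i, f j) \<in> parcs G \<longleftrightarrow> (f i, f j) \<in> arcs H"
      using that by (simp add: arcs' verts)
    also have "\<dots> \<longleftrightarrow> (i, j) \<in> parcs W"
    proof
      assume "(f i, f j) \<in> arcs H"
      then obtain k l where kl: "(k, l) \<in> parcs W" "f i = f k" "f j = f l"
        unfolding arcs by auto
      then have "k \<in> pverts W" "l \<in> pverts W"
        using W.in_arcsD1 W.in_arcsD2 by blast+
      with kl that inj show "(i, j) \<in> parcs W"
        by (metis inj_onD)
    qed (auto simp: arcs)
    finally show ?thesis .
  qed
  moreover have "f ` pverts W \<subseteq> pverts G"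
    using ind unfolding verts[symmetric] induced_subgraph_def subgraph_def by simp
  ultimately show ?R using inj by blast
next
  interpret W: pair_wf_digraph W by fact
  interpret G: pair_wf_digraph G by fact
  assume ?R
  then obtain f where inj: "inj_on f (pverts W)" and sub: "f ` pverts W \<subseteq> pverts G"
    and f: "\<And>i j. i \<in> pverts W \<Longrightarrow> j \<in> pverts W \<Longrightarrow> (f i, f j) \<in> parcs G \<longleftrightarrow> (i, j) \<in> parcs W"
    by blast
  define H where "H = with_proj \<lparr>pverts = f ` pverts W,
    parcs = {e \<in> parcs G. fst e \<in> f ` pverts W \<and> snd e \<in> f ` pverts W}\<rparr>"
  have wfH: "wf_digraph H"
    unfolding H_def wf_digraph_wp_iff by (simp add: pair_wf_digraph_def)
  have ind: "induced_subgraph H (with_proj G)"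
    using sub wfH G.wf_digraph_axioms
    by (auto simp: induced_subgraph_def subgraph_def compatible_def H_def)
  define g :: "('b, 'b \<times> 'b, 'a, 'a \<times> 'a) digraph_isomorphism" where
    "g = \<lparr>iso_verts = f, iso_arcs = map_prod f f, iso_head = snd, iso_tail = fst\<rparr>"
  have "inj_on (map_prod f f) (parcs W)"
    by (rule inj_on_subset[OF map_prod_inj_on[OF inj inj]]) (use W.in_arcsD1 W.in_arcsD2 in auto)
  then have "pre_digraph.digraph_isomorphism (with_proj W) g"
    using inj W.wf_digraph_axioms by (auto simp: pre_digraph.digraph_isomorphism_def g_def)
  moreover have "H = app_iso g (with_proj W)"
  proof -
    have "{e \<in> parcs G. fst e \<in> f ` pverts W \<and> snd e \<in> f ` pverts W} = map_prod f f ` parcs W"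
      using f W.in_arcsD1 W.in_arcsD2 by force
    then show ?thesis by (simp add: H_def app_iso_def g_def with_proj_def)
  qed
  ultimately have "digraph_iso (with_proj W) H"
    unfolding digraph_iso_def by blast
  with ind show ?L
    unfolding contains_induced_def using digraph_iso_swap W.wf_digraph_axioms by blast
qed

section \<open>Forced directions and the non-orientability of the forbidden graphs\<close>

text \<open>Directing the induced path \<open>x\<close>, \<open>y\<close>, \<open>z\<close> through
  \<open>y\<close>, either way, would make its ends adjacent by transitivity.\<close>

lemma transitive_orientation_forced:
  assumes "transitive_orientation G F" "(x, y) \<in> parcs G" "(y, z) \<in> parcs G" "(x, z) \<notin> parcs G"
  shows "(x, y) \<in> F \<longleftrightarrow> (z, y) \<in> F"
  using assms unfolding transitive_orientation_def trans_def by blast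

lemma transitive_orientation_flip:
  assumes "transitive_orientation G F" "(x, y) \<in> parcs G"
  shows "(x, y) \<in> F \<longleftrightarrow> (y, x) \<notin> F"
  using assms unfolding transitive_orientation_def by blast

text \<open>The conditions on an orientation quantify over vertices only universally, so they pass
  to the pullback along an embedding.\<close>

lemma transitive_orientation_induced:
  assumes "pair_wf_digraph G" "pair_wf_digraph W" "contains_induced G W"
    and F: "transitive_orientation G F"
  obtains F' where "transitive_orientation W F'"
proof -
  interpret W: pair_wf_digraph W by fact
  obtain f where f: "\<forall>i\<in>pverts W. \<forall>j\<in>pverts W. (f i, f j) \<in> parcs G \<longleftrightarrow> (i, j) \<in> parcs W"
    using assms by (auto simp: contains_induced_iff)
  define F' where "F' = {(i, j). i \<in> pverts W \<and> j \<in> pverts W \<and> (f i, f j) \<in> F}"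
  have *: "(i, j) \<in> F' \<or> (j, i) \<in> F' \<longleftrightarrow> (i, j) \<in> parcs W" for i j
    using F f W.in_arcsD1[of i j] W.in_arcsD2[of i j]
    unfolding F'_def transitive_orientation_def by blast
  have "F' \<union> F'\<inverse> = parcs W"
    by (rule set_eqI) (use * in auto)
  moreover have "F' \<inter> F'\<inverse> = {}"
    using F unfolding F'_def transitive_orientation_def by blast
  moreover have "trans F'"
    using F unfolding F'_def transitive_orientation_def trans_def by blast
  ultimately have "transitive_orientation W F'"
    unfolding transitive_orientation_def by simp
  then show ?thesis by (rule that)
qed

lemma pair_wf_W:
  "pair_wf_digraph W1" "pair_wf_digraph W2" "pair_wf_digraph W3" "pair_wf_digraph W4"
  unfolding W1_def W2_def W3_def W4_def by (auto intro!: pair_wf_undirected_graph)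

text \<open>At each corner of the triangle 3, 4, 5 the pendant neighbour forces both triangle edges
  the same way, so the directions would alternate around an odd cycle.\<close>

lemma W1_not_orientable: "\<not> transitive_orientation W1 F"
proof
  assume F: "transitive_orientation W1 F"
  note a = transitive_orientation_forced[OF F] and b = transitive_orientation_flip[OF F]
  show False
    using a[of 1 3 4] a[of 1 3 5] a[of 2 4 3] a[of 2 4 5] a[of 6 5 3] a[of 6 5 4]
      b[of 3 4] b[of 4 5] b[of 3 5]
    by (simp add: W1_def undirected_graph_def)
qed

text \<open>Again the directions would alternate around a triangle, here 2, 4, 5. At each corner the
  two triangle edges are linked through its two outer neighbours.\<close>

lemma W2_not_orientable: "\<not> transitive_orientation W2 F"
proof
  assume F: "transitive_orientation W2 F"
  note a = transitive_orientation_forced[OF F] and b = transitive_orientation_flip[OF F]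
  show False
    using a[of 1 2 5] a[of 1 2 3] a[of 4 2 3] a[of 1 4 5] a[of 1 4 6] a[of 2 4 6]
      a[of 3 5 4] a[of 3 5 6] a[of 2 5 6] b[of 2 4] b[of 4 5] b[of 2 5]
    by (simp add: W2_def undirected_graph_def)
qed

text \<open>The triangle 3, 4, 5 combines both mechanisms: pendants at 3 and 4, the linked
  neighbours 6 and 7 at 5.\<close>

lemma W3_not_orientable: "\<not> transitive_orientation W3 F"
proof
  assume F: "transitive_orientation W3 F"
  note a = transitive_orientation_forced[OF F] and b = transitive_orientation_flip[OF F]
  show False
    using a[of 1 3 4] a[of 1 3 5] a[of 2 4 3] a[of 2 4 5] a[of 6 5 7] a[of 6 5 4] a[of 3 5 7]
      b[of 3 4] b[of 4 5] b[of 3 5]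
    by (simp add: W3_def undirected_graph_def)
qed

text \<open>Here the odd cycle is 1, 4, 2, 3, 5: the pendants 6 and 7 force alternation at 4 and 5,
  and at 1, 2 and 3 the two cycle neighbours are nonadjacent.\<close>

lemma W4_not_orientable: "\<not> transitive_orientation W4 F"
proof
  assume F: "transitive_orientation W4 F"
  note a = transitive_orientation_forced[OF F] and b = transitive_orientation_flip[OF F]
  show False
    using a[of 6 4 1] a[of 6 4 2] a[of 7 5 1] a[of 7 5 3] a[of 4 1 5] a[of 4 2 3] a[of 2 3 5]
      b[of 1 4] b[of 2 4] b[of 1 5] b[of 3 5] b[of 2 3]
    by (simp add: W4_def undirected_graph_def)
qed

lemma comparability_graph_no_W:
  assumes "comparability_graph G"
  shows "\<not> contains_induced G W1" "\<not> contains_induced G W2"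
    "\<not> contains_induced G W3" "\<not> contains_induced G W4"
proof -
  obtain F where F: "transitive_orientation G F" and "pair_graph G"
    using assms by (auto simp: comparability_graph_def)
  then interpret pair_graph G by simp
  have *: "\<not> contains_induced G W"
    if "pair_wf_digraph W" "\<And>F'. \<not> transitive_orientation W F'" for W :: "nat pair_pre_digraph"
    using transitive_orientation_induced[OF pair_wf_digraph_axioms that(1) _ F] that(2) by metis
  show "\<not> contains_induced G W1" "\<not> contains_induced G W2"
    "\<not> contains_induced G W3" "\<not> contains_induced G W4"
    by (rule *; fact pair_wf_W W1_not_orientable W2_not_orientable W3_not_orientable W4_not_orientable)+
qed

text \<open>Injectivity comes for free, since in \<open>W\<close> distinct vertices have distinct neighbourhoods.\<close>
lemma contains_inducedI:
  assumes "pair_wf_digraph G" "pair_wf_digraph W"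
    and f: "\<And>i j. i \<in> pverts W \<Longrightarrow> j \<in> pverts W \<Longrightarrow> (f i, f j) \<in> parcs G \<longleftrightarrow> (i, j) \<in> parcs W"
    and pd: "\<And>i j. i \<in> pverts W \<Longrightarrow> j \<in> pverts W \<Longrightarrow>
      (\<forall>k\<in>pverts W. (i, k) \<in> parcs W \<longleftrightarrow> (j, k) \<in> parcs W) \<Longrightarrow> i = j"
    and ne: "\<And>i. i \<in> pverts W \<Longrightarrow> \<exists>k\<in>pverts W. (i, k) \<in> parcs W"
  shows "contains_induced G W"
proof -
  interpret W: pair_wf_digraph W by fact
  interpret G: pair_wf_digraph G by fact
  have "inj_on f (pverts W)"
  proof (rule inj_onI)
    fix i j assume ij: "i \<in> pverts W" "j \<in> pverts W" "f i = f j"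
    then have "\<forall>k\<in>pverts W. (i, k) \<in> parcs W \<longleftrightarrow> (j, k) \<in> parcs W"
      using f by metis
    with pd ij show "i = j" by blast
  qed
  moreover have "f ` pverts W \<subseteq> pverts G"
    using ne f G.in_arcsD1 by blast
  ultimately show ?thesis
    using f assms(1,2) by (subst contains_induced_iff) auto
qed

section \<open>Recognising the forbidden graphs from their adjacencies\<close>

lemma (in pair_graph) no_self_loop: "(u, u) \<notin> parcs G"
  using no_loops' by blast

lemma (in pair_graph) not_arcs_symmetric: "(u, v) \<notin> parcs G \<Longrightarrow> (v, u) \<notin> parcs G"
  using arcs_symmetric by blast

lemma (in pair_graph) contains_W1I:
  assumes adj: "(x1,x3) \<in> parcs G" "(x2,x4) \<in> parcs G" "(x3,x4) \<in> parcs G" "(x3,x5) \<in> parcs G"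
    "(x4,x5) \<in> parcs G" "(x5,x6) \<in> parcs G"
    and nadj: "(x1,x2) \<notin> parcs G" "(x1,x4) \<notin> parcs G" "(x1,x5) \<notin> parcs G" "(x1,x6) \<notin> parcs G"
    "(x2,x3) \<notin> parcs G" "(x2,x5) \<notin> parcs G" "(x2,x6) \<notin> parcs G" "(x3,x6) \<notin> parcs G"
    "(x4,x6) \<notin> parcs G"
  shows "contains_induced G W1"
proof -
  have V: "pverts W1 = {1,2,3,4,5,6}"
    by (auto simp: W1_def undirected_graph_def)
  define f :: "nat \<Rightarrow> 'a" where "f = (\<lambda>_. x1)(2 := x2, 3 := x3, 4 := x4, 5 := x5, 6 := x6)"
  have "\<forall>i\<in>pverts W1. \<forall>j\<in>pverts W1. (f i, f j) \<in> parcs G \<longleftrightarrow> (i, j) \<in> parcs W1"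
    using adj adj[THEN arcs_symmetric] nadj nadj[THEN not_arcs_symmetric]
    by (simp add: V f_def no_self_loop) (simp add: W1_def undirected_graph_def)
  moreover have "\<forall>i\<in>pverts W1. \<forall>j\<in>pverts W1.
      (\<forall>k\<in>pverts W1. (i, k) \<in> parcs W1 \<longleftrightarrow> (j, k) \<in> parcs W1) \<longrightarrow> i = j"
    by (simp add: V) (simp add: W1_def undirected_graph_def)
  moreover have "\<forall>i\<in>pverts W1. \<exists>k\<in>pverts W1. (i, k) \<in> parcs W1"
    by (simp add: V) (simp add: W1_def undirected_graph_def)
  ultimately show ?thesis
    by (intro contains_inducedI[where f = f] pair_wf_digraph_axioms pair_wf_W) auto
qed

lemma (in pair_graph) contains_W2I:
  assumes adj: "(x1,x2) \<in> parcs G" "(x2,x3) \<in> parcs G" "(x1,x4) \<in> parcs G" "(x2,x4) \<in> parcs G"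
    "(x2,x5) \<in> parcs G" "(x3,x5) \<in> parcs G" "(x4,x5) \<in> parcs G" "(x4,x6) \<in> parcs G"
    "(x5,x6) \<in> parcs G"
    and nadj: "(x1,x3) \<notin> parcs G" "(x1,x5) \<notin> parcs G" "(x1,x6) \<notin> parcs G" "(x2,x6) \<notin> parcs G"
    "(x3,x4) \<notin> parcs G" "(x3,x6) \<notin> parcs G"
  shows "contains_induced G W2"
proof -
  have V: "pverts W2 = {1,2,3,4,5,6}"
    by (auto simp: W2_def undirected_graph_def)
  define f :: "nat \<Rightarrow> 'a" where "f = (\<lambda>_. x1)(2 := x2, 3 := x3, 4 := x4, 5 := x5, 6 := x6)"
  have "\<forall>i\<in>pverts W2. \<forall>j\<in>pverts W2. (f i, f j) \<in> parcs G \<longleftrightarrow> (i, j) \<in> parcs W2"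
    using adj adj[THEN arcs_symmetric] nadj nadj[THEN not_arcs_symmetric]
    by (simp add: V f_def no_self_loop) (simp add: W2_def undirected_graph_def)
  moreover have "\<forall>i\<in>pverts W2. \<forall>j\<in>pverts W2.
      (\<forall>k\<in>pverts W2. (i, k) \<in> parcs W2 \<longleftrightarrow> (j, k) \<in> parcs W2) \<longrightarrow> i = j"
    by (simp add: V) (simp add: W2_def undirected_graph_def)
  moreover have "\<forall>i\<in>pverts W2. \<exists>k\<in>pverts W2. (i, k) \<in> parcs W2"
    by (simp add: V) (simp add: W2_def undirected_graph_def)
  ultimately show ?thesis
    by (intro contains_inducedI[where f = f] pair_wf_digraph_axioms pair_wf_W) auto
qed

lemma (in pair_graph) contains_W3I:
  assumes adj: "(x1,x3) \<in> parcs G" "(x2,x4) \<in> parcs G" "(x3,x4) \<in> parcs G" "(x3,x5) \<in> parcs G"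
    "(x4,x5) \<in> parcs G" "(x3,x6) \<in> parcs G" "(x5,x6) \<in> parcs G" "(x4,x7) \<in> parcs G"
    "(x5,x7) \<in> parcs G"
    and nadj: "(x1,x2) \<notin> parcs G" "(x1,x4) \<notin> parcs G" "(x1,x5) \<notin> parcs G" "(x1,x6) \<notin> parcs G"
    "(x1,x7) \<notin> parcs G" "(x2,x3) \<notin> parcs G" "(x2,x5) \<notin> parcs G" "(x2,x6) \<notin> parcs G"
    "(x2,x7) \<notin> parcs G" "(x3,x7) \<notin> parcs G" "(x4,x6) \<notin> parcs G" "(x6,x7) \<notin> parcs G"
  shows "contains_induced G W3"
proof -
  have V: "pverts W3 = {1,2,3,4,5,6,7}"
    by (auto simp: W3_def undirected_graph_def)
  define f :: "nat \<Rightarrow> 'a" where "f = (\<lambda>_. x1)(2 := x2, 3 := x3, 4 := x4, 5 := x5, 6 := x6, 7 := x7)"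
  have "\<forall>i\<in>pverts W3. \<forall>j\<in>pverts W3. (f i, f j) \<in> parcs G \<longleftrightarrow> (i, j) \<in> parcs W3"
    using adj adj[THEN arcs_symmetric] nadj nadj[THEN not_arcs_symmetric]
    by (simp add: V f_def no_self_loop) (simp add: W3_def undirected_graph_def)
  moreover have "\<forall>i\<in>pverts W3. \<forall>j\<in>pverts W3.
      (\<forall>k\<in>pverts W3. (i, k) \<in> parcs W3 \<longleftrightarrow> (j, k) \<in> parcs W3) \<longrightarrow> i = j"
    by (simp add: V) (simp add: W3_def undirected_graph_def)
  moreover have "\<forall>i\<in>pverts W3. \<exists>k\<in>pverts W3. (i, k) \<in> parcs W3"
    by (simp add: V) (simp add: W3_def undirected_graph_def)
  ultimately show ?thesis
    by (intro contains_inducedI[where f = f] pair_wf_digraph_axioms pair_wf_W) auto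
qed

lemma (in pair_graph) contains_W4I:
  assumes adj: "(x1,x2) \<in> parcs G" "(x1,x3) \<in> parcs G" "(x1,x4) \<in> parcs G" "(x1,x5) \<in> parcs G"
    "(x2,x3) \<in> parcs G" "(x2,x4) \<in> parcs G" "(x3,x5) \<in> parcs G" "(x4,x6) \<in> parcs G"
    "(x5,x7) \<in> parcs G"
    and nadj: "(x1,x6) \<notin> parcs G" "(x1,x7) \<notin> parcs G" "(x2,x5) \<notin> parcs G" "(x2,x6) \<notin> parcs G"
    "(x2,x7) \<notin> parcs G" "(x3,x4) \<notin> parcs G" "(x3,x6) \<notin> parcs G" "(x3,x7) \<notin> parcs G"
    "(x4,x5) \<notin> parcs G" "(x4,x7) \<notin> parcs G" "(x5,x6) \<notin> parcs G" "(x6,x7) \<notin> parcs G"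
  shows "contains_induced G W4"
proof -
  have V: "pverts W4 = {1,2,3,4,5,6,7}"
    by (auto simp: W4_def undirected_graph_def)
  define f :: "nat \<Rightarrow> 'a" where "f = (\<lambda>_. x1)(2 := x2, 3 := x3, 4 := x4, 5 := x5, 6 := x6, 7 := x7)"
  have "\<forall>i\<in>pverts W4. \<forall>j\<in>pverts W4. (f i, f j) \<in> parcs G \<longleftrightarrow> (i, j) \<in> parcs W4"
    using adj adj[THEN arcs_symmetric] nadj nadj[THEN not_arcs_symmetric]
    by (simp add: V f_def no_self_loop) (simp add: W4_def undirected_graph_def)
  moreover have "\<forall>i\<in>pverts W4. \<forall>j\<in>pverts W4.
      (\<forall>k\<in>pverts W4. (i, k) \<in> parcs W4 \<longleftrightarrow> (j, k) \<in> parcs W4) \<longrightarrow> i = j"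
    by (simp add: V) (simp add: W4_def undirected_graph_def)
  moreover have "\<forall>i\<in>pverts W4. \<exists>k\<in>pverts W4. (i, k) \<in> parcs W4"
    by (simp add: V) (simp add: W4_def undirected_graph_def)
  ultimately show ?thesis
    by (intro contains_inducedI[where f = f] pair_wf_digraph_axioms pair_wf_W) auto
qed

section \<open>Covering by two chains\<close>

definition comparable :: "'a::order \<Rightarrow> 'a \<Rightarrow> bool" where
  "comparable x y \<longleftrightarrow> x \<le> y \<or> y \<le> x"

lemma comparable_commute: "comparable x y \<longleftrightarrow> comparable y x"
  by (auto simp: comparable_def)

lemma finite_chain_has_greatest:
  fixes f :: "'a \<Rightarrow> 'b::order"
  assumes "finite X" "X \<noteq> {}" and chain: "\<And>x y. x \<in> X \<Longrightarrow> y \<in> X \<Longrightarrow> comparable (f x) (f y)"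
  obtains m where "m \<in> X" "\<And>x. x \<in> X \<Longrightarrow> f x \<le> f m"
proof -
  obtain m where "m \<in> X" and m: "\<And>x. x \<in> X \<Longrightarrow> f m \<le> f x \<Longrightarrow> f m = f x"
    using finite_has_maximal[of "f ` X"] assms(1,2) by auto
  with chain that show ?thesis
    unfolding comparable_def by metis
qed

lemma finite_chain_has_least:
  fixes f :: "'a \<Rightarrow> 'b::order"
  assumes "finite X" "X \<noteq> {}" and chain: "\<And>x y. x \<in> X \<Longrightarrow> y \<in> X \<Longrightarrow> comparable (f x) (f y)"
  obtains m where "m \<in> X" "\<And>x. x \<in> X \<Longrightarrow> f m \<le> f x"
proof -
  obtain m where "m \<in> X" and m: "\<And>x. x \<in> X \<Longrightarrow> f x \<le> f m \<Longrightarrow> f m = f x"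
    using finite_has_minimal[of "f ` X"] assms(1,2) by auto
  with chain that show ?thesis
    unfolding comparable_def by metis
qed

text \<open>Dilworth's theorem for width two, after Galvin.\<close>
lemma two_chain_cover:
  fixes f :: "'a \<Rightarrow> 'b::order"
  assumes "finite X"
    and "\<And>x y z. x \<in> X \<Longrightarrow> y \<in> X \<Longrightarrow> z \<in> X \<Longrightarrow>
      comparable (f x) (f y) \<or> comparable (f x) (f z) \<or> comparable (f y) (f z)"
  shows "\<exists>c :: 'a \<Rightarrow> bool. \<forall>x\<in>X. \<forall>y\<in>X. c x = c y \<longrightarrow> comparable (f x) (f y)"
  using assms
proof (induction "card X" arbitrary: X)
  case 0
  then show ?case by simp
next
  case (Suc n)
  let ?cmp = "\<lambda>x y. comparable (f x) (f y)"
  have "X \<noteq> {}" using Suc.hyps(2) by auto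
  \<comment> \<open>By maximality, whatever is comparable to \<open>x\<close> lies below it.\<close>
  then obtain x where x: "x \<in> X" and x_max: "\<And>y. y \<in> X \<Longrightarrow> f x \<le> f y \<Longrightarrow> f x = f y"
    using finite_has_maximal[of "f ` X"] Suc.prems(1) by auto
  define X' where "X' = X - {x}"
  have X: "X = insert x X'" and fin: "finite X'" and sub: "\<And>z. z \<in> X' \<Longrightarrow> z \<in> X"
    using x Suc.prems(1) by (auto simp: X'_def)
  have "n = card X'" using Suc.hyps(2) x Suc.prems(1) by (simp add: X'_def)
  then have "\<exists>c :: 'a \<Rightarrow> bool. \<forall>y\<in>X'. \<forall>z\<in>X'. c y = c z \<longrightarrow> ?cmp y z"
    by (rule Suc.hyps(1)[OF _ fin]) (use Suc.prems(2) sub in simp)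
  then obtain c :: "'a \<Rightarrow> bool"
    where c: "\<And>y z. y \<in> X' \<Longrightarrow> z \<in> X' \<Longrightarrow> c y = c z \<Longrightarrow> ?cmp y z"
    by blast
  \<comment> \<open>\<open>I k\<close> collects the elements of colour \<open>k\<close> that prevent
    \<open>X'\<close> from being a single chain.\<close>
  define I where "I k = {y \<in> X'. c y = k \<and> (\<exists>z\<in>X'. \<not> ?cmp y z)}" for k
  have partner: "\<exists>z\<in>I (\<not> k). \<not> ?cmp y z" if y: "y \<in> I k" for y k
  proof -
    obtain z where z: "z \<in> X'" "\<not> ?cmp y z"
      using y by (auto simp: I_def)
    have "c z \<noteq> c y" using z c[of y z] y by (auto simp: I_def)
    then have "z \<in> I (\<not> k)"
      using z y comparable_commute[of "f y" "f z"] by (auto simp: I_def)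
    with z show ?thesis by blast
  qed
  show ?case
  proof (cases "I True = {}")
    case True
    then have "I False = {}" using partner[of _ False] by auto
    with True have chain: "?cmp y z" if "y \<in> X'" "z \<in> X'" for y z
      using that unfolding I_def by (cases "c y") auto
    \<comment> \<open>\<open>X'\<close> is one chain and \<open>x\<close> alone is the
      other.\<close>
    show ?thesis
    proof (intro exI ballI impI)
      fix y z assume "y \<in> X" "z \<in> X" "(y = x) = (z = x)"
      then show "?cmp y z" using chain[of y z] by (cases "y = x") (auto simp: X comparable_def)
    qed
  next
    case False
    then have ne: "I k \<noteq> {}" for k using partner[of _ True] by (cases k) auto
    have fI: "finite (I k)" for k using fin by (simp add: I_def)
    have "\<exists>m. m \<in> I k \<and> (\<forall>y\<in>I k. f y \<le> f m)" for k
      by (rule finite_chain_has_greatest[OF fI ne, of k f]) (use c in \<open>auto simp: I_def\<close>)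
    then obtain m where m: "\<And>k. m k \<in> I k" and m_max: "\<And>k y. y \<in> I k \<Longrightarrow> f y \<le> f (m k)"
      by metis
    \<comment> \<open>A partner of \<open>m (\<not> k)\<close> lies in \<open>I k\<close>, hence
      below \<open>m k\<close>. If \<open>m k\<close> were below \<open>m (\<not> k)\<close>, the
      partners would be comparable.\<close>
    have no: "\<not> f (m k) \<le> f (m (\<not> k))" for k
    proof
      assume le: "f (m k) \<le> f (m (\<not> k))"
      obtain z where z: "z \<in> I k" "\<not> ?cmp (m (\<not> k)) z"
        using partner[OF m[of "\<not> k"]] by auto
      then show False using m_max[OF z(1)] le by (auto simp: comparable_def)
    qed
    \<comment> \<open>The two tops are incomparable, so the width condition makes \<open>x\<close>
      comparable to one of them, and maximality puts \<open>x\<close> above it.\<close>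
    have "\<not> ?cmp (m True) (m False)"
      using no[of True] no[of False] by (auto simp: comparable_def)
    moreover have "m k \<in> X" for k using m[of k] sub by (auto simp: I_def)
    ultimately obtain k where "?cmp x (m k)"
      using Suc.prems(2)[OF x, of "m True" "m False"] by blast
    then have k: "f (m k) \<le> f x"
      using x_max[OF \<open>m k \<in> X\<close>] by (auto simp: comparable_def)
    \<comment> \<open>\<open>x\<close> goes on top of the elements of colour \<open>k\<close> below
      \<open>m k\<close>. An element of colour \<open>k\<close> left out is not in
      \<open>I k\<close>, so it is comparable to all of \<open>X'\<close> and can join the other
      chain.\<close>
    define c' where "c' z \<longleftrightarrow> z = x \<or> c z = k \<and> f z \<le> f (m k)" for z
    have "?cmp y z" if "y \<in> X" "z \<in> X" "c' y = c' z" for y z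
    proof (cases "y = x \<or> z = x")
      case True
      then show ?thesis using that k by (auto simp: c'_def comparable_def)
    next
      case False
      then have yz: "y \<in> X'" "z \<in> X'" using that by (auto simp: X'_def)
      show ?thesis
      proof (rule ccontr)
        assume n: "\<not> ?cmp y z"
        then have "c y \<noteq> c z" using c yz by blast
        moreover have "c' u" if "u \<in> {y, z}" "c u = k" for u
        proof -
          have "u \<in> I k"
            using n yz that comparable_commute[of "f y" "f z"] by (auto simp: I_def)
          then show ?thesis using m_max that by (auto simp: c'_def)
        qed
        ultimately show False
          using \<open>c' y = c' z\<close> False unfolding c'_def by (cases "c y = k") auto
      qed
    qed
    then show ?thesis by blast
  qed
qed

text \<open>The union \<open>M\<close> of all members of \<open>\<F>\<close> through a given element is again an up-closed chain, and
  any two elements of a common member yield the same \<open>M\<close>. Whatever is incomparable to some element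
  of \<open>M\<close> is incomparable to its least element, so all of \<open>M\<close> may take over the colour of the latter.\<close>
lemma two_chain_cover_laminar:
  fixes f :: "'a \<Rightarrow> 'b::order"
  assumes fin: "finite X"
    and width: "\<And>x y z. x \<in> X \<Longrightarrow> y \<in> X \<Longrightarrow> z \<in> X \<Longrightarrow>
      comparable (f x) (f y) \<or> comparable (f x) (f z) \<or> comparable (f y) (f z)"
    and sub: "\<And>S. S \<in> \<F> \<Longrightarrow> S \<subseteq> X"
    and laminar: "\<And>S S'. S \<in> \<F> \<Longrightarrow> S' \<in> \<F> \<Longrightarrow> S \<subseteq> S' \<or> S' \<subseteq> S \<or> S \<inter> S' = {}"
    and chain: "\<And>S x y. S \<in> \<F> \<Longrightarrow> x \<in> S \<Longrightarrow> y \<in> S \<Longrightarrow> comparable (f x) (f y)"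
    and up: "\<And>S x y. S \<in> \<F> \<Longrightarrow> x \<in> S \<Longrightarrow> y \<in> X \<Longrightarrow> f x \<le> f y \<Longrightarrow> y \<in> S"
  obtains c :: "'a \<Rightarrow> bool"
  where "\<And>x y. x \<in> X \<Longrightarrow> y \<in> X \<Longrightarrow> c x = c y \<Longrightarrow> comparable (f x) (f y)"
    and "\<And>S x y. S \<in> \<F> \<Longrightarrow> x \<in> S \<Longrightarrow> y \<in> S \<Longrightarrow> c x = c y"
proof -
  let ?cmp = "\<lambda>x y. comparable (f x) (f y)"
  have "\<exists>c :: 'a \<Rightarrow> bool. \<forall>x\<in>X. \<forall>y\<in>X. c x = c y \<longrightarrow> ?cmp x y"
    by (rule two_chain_cover[OF fin width])
  then obtain c :: "'a \<Rightarrow> bool"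
    where c: "\<And>x y. x \<in> X \<Longrightarrow> y \<in> X \<Longrightarrow> c x = c y \<Longrightarrow> ?cmp x y"
    by blast
  define M where "M y = \<Union>{S \<in> \<F>. y \<in> S}" for y
  have M_eq: "M x = M y" if "S \<in> \<F>" "x \<in> S" "y \<in> S" for S x y
    using laminar[OF _ that(1)] that unfolding M_def by blast
  have M_sub: "M y \<subseteq> X" for y using sub by (auto simp: M_def)
  have M_chain: "?cmp u v" if uv: "u \<in> M y" "v \<in> M y" for u v y
  proof -
    obtain S S' where S: "S \<in> \<F>" "S' \<in> \<F>" "y \<in> S" "y \<in> S'" "u \<in> S" "v \<in> S'"
      using uv by (auto simp: M_def)
    then have "S \<subseteq> S' \<or> S' \<subseteq> S" using laminar[of S S'] by blast
    with S chain show ?thesis by blast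
  qed
  have M_up: "v \<in> M y" if "u \<in> M y" "v \<in> X" "f u \<le> f v" for u v y
    using that up unfolding M_def by blast
  \<comment> \<open>The choice depends on the set alone, so elements with equal \<open>M\<close>
    share their representative.\<close>
  define g where "g N = (SOME z. z \<in> N \<and> (\<forall>w\<in>N. f z \<le> f w))" for N
  have g: "g (M y) \<in> M y \<and> (\<forall>w\<in>M y. f (g (M y)) \<le> f w)" if "M y \<noteq> {}" for y
  proof -
    have "\<exists>z. z \<in> M y \<and> (\<forall>w\<in>M y. f z \<le> f w)"
      by (rule finite_chain_has_least[of "M y" f])
        (use finite_subset[OF M_sub fin] that M_chain in blast)+
    then show ?thesis unfolding g_def by (rule someI_ex)
  qed
  define r where "r y = (if M y = {} then y else g (M y))" for y
  have self: "y \<in> M y" if "M y \<noteq> {}" for y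
    using that by (auto simp: M_def)
  have rX: "r y \<in> X" if "y \<in> X" for y
    using that g M_sub by (auto simp: r_def)
  have r_inc: "\<not> ?cmp (r y) z" if "y \<in> X" "z \<in> X" "\<not> ?cmp y z" for y z
  proof (cases "M y = {}")
    case True
    then show ?thesis using that by (simp add: r_def)
  next
    case False
    then have "z \<notin> M y" "f (r y) \<le> f y" "r y \<in> M y"
      using that M_chain self[of y] g[of y] by (auto simp: r_def)
    then show ?thesis
      using that M_up[of "r y" y z] unfolding comparable_def by (meson order_trans)
  qed
  show ?thesis
  proof (rule that[of "\<lambda>y. c (r y)"])
    fix x y assume xy: "x \<in> X" "y \<in> X" "c (r x) = c (r y)"
    show "?cmp x y"
    proof (rule ccontr)
      assume "\<not> ?cmp x y"
      then have "\<not> ?cmp (r x) (r y)"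
        using r_inc xy rX comparable_commute by metis
      then show False using c rX xy by blast
    qed
  next
    fix S x y assume S: "S \<in> \<F>" "x \<in> S" "y \<in> S"
    then have "M x \<noteq> {}" by (auto simp: M_def)
    then show "c (r x) = c (r y)" using M_eq[OF S] by (simp add: r_def)
  qed
qed

section \<open>Forests\<close>

definition forest_rel :: "'a rel \<Rightarrow> bool" where
  "forest_rel T \<longleftrightarrow> sym T \<and> irrefl T \<and>
    (\<forall>vs. distinct vs \<and> 3 \<le> length vs \<and> successively (\<lambda>x y. (x, y) \<in> T) vs \<longrightarrow> (last vs, hd vs) \<notin> T)"

text \<open>The first vertex \<open>h\<close> of a longest path in \<open>X\<close> will do: a
  neighbour off the path would extend it, and one beyond the second vertex would close a
  cycle.\<close>

lemma forest_rel_leaf: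
  assumes T: "forest_rel T" and "finite X" "X \<noteq> {}"
  obtains h where "h \<in> X" "\<And>u v. u \<in> X \<Longrightarrow> v \<in> X \<Longrightarrow> (h, u) \<in> T \<Longrightarrow> (h, v) \<in> T \<Longrightarrow> u = v"
proof -
  let ?path = "\<lambda>vs. vs \<noteq> [] \<and> distinct vs \<and> set vs \<subseteq> X \<and> successively (\<lambda>x y. (x, y) \<in> T) vs"
  obtain x where "x \<in> X" using assms by auto
  then have "?path [x]" by simp
  moreover have "length vs < Suc (card X)" if "?path vs" for vs
    using that card_mono[OF assms(2), of "set vs"] by (simp add: distinct_card less_Suc_eq_le)
  ultimately obtain vs where vs: "?path vs" and max: "\<And>ws. ?path ws \<Longrightarrow> length ws \<le> length vs"
    using ex_has_greatest_nat[of ?path "[x]" length] by metis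
  obtain h ws where hws: "vs = h # ws" using vs by (cases vs) auto
  have nb: "ws \<noteq> [] \<and> u = hd ws" if u: "u \<in> X" "(h, u) \<in> T" for u
  proof -
    have "(u, h) \<in> T" using T u by (auto simp: forest_rel_def sym_def)
    then have "u \<in> set vs"
      using max[of "u # vs"] vs u hws by (auto simp: successively_Cons)
    moreover have "u \<noteq> h" using T u by (auto simp: forest_rel_def irrefl_def)
    ultimately have "u \<in> set ws" using hws by auto
    then obtain as bs where ws: "ws = as @ u # bs" by (meson split_list)
    have "as = []"
    proof (rule ccontr)
      assume ne: "as \<noteq> []"
      let ?c = "h # as @ [u]"
      have "vs = ?c @ bs" by (simp add: hws ws)
      then have "distinct ?c" "successively (\<lambda>x y. (x, y) \<in> T) ?c"
        using vs by (metis distinct_append, metis successively_append_iff)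
      moreover have "3 \<le> length ?c" using ne by (cases as) auto
      ultimately have "(last ?c, hd ?c) \<notin> T"
        using T unfolding forest_rel_def by blast
      then show False using \<open>(u, h) \<in> T\<close> by simp
    qed
    then show ?thesis by (simp add: ws)
  qed
  have "h \<in> X" using vs hws by auto
  then show ?thesis using nb that by metis
qed

text \<open>Each edge demands equal or different values at its ends, according to \<open>q\<close>.
  After the vertices other than a leaf are settled, the leaf faces at most one demand.\<close>

lemma forest_rel_potential:
  assumes T: "forest_rel T" and "finite X" and q: "\<And>u v. q u v \<longleftrightarrow> q v u"
  shows "\<exists>p :: 'a \<Rightarrow> bool. \<forall>u\<in>X. \<forall>v\<in>X. (u, v) \<in> T \<longrightarrow> (p u = p v \<longleftrightarrow> q u v)"
  using assms(2)
proof (induction "card X" arbitrary: X)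
  case 0
  then show ?case by simp
next
  case (Suc n)
  then have "X \<noteq> {}" by auto
  then obtain h where h: "h \<in> X"
    and leaf: "\<And>u v. u \<in> X \<Longrightarrow> v \<in> X \<Longrightarrow> (h, u) \<in> T \<Longrightarrow> (h, v) \<in> T \<Longrightarrow> u = v"
    using forest_rel_leaf[OF T Suc.prems] by metis
  have T': "sym T" "irrefl T" using T by (auto simp: forest_rel_def)
  have "n = card (X - {h})" using Suc h by simp
  then obtain p :: "'a \<Rightarrow> bool" where p: "\<forall>u\<in>X - {h}. \<forall>v\<in>X - {h}. (u, v) \<in> T \<longrightarrow> (p u = p v \<longleftrightarrow> q u v)"
    using Suc.hyps(1)[of "X - {h}"] Suc.prems by auto
  \<comment> \<open>For the only neighbour \<open>u\<close> of \<open>h\<close>, this makes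
    \<open>b\<close> equal to \<open>p u\<close> exactly when \<open>q h u\<close> holds; without a
    neighbour \<open>b\<close> is \<open>False\<close>.\<close>
  define b where "b \<longleftrightarrow> (\<exists>u\<in>X. (h, u) \<in> T \<and> (p u \<longleftrightarrow> q h u))"
  have b: "b = p u \<longleftrightarrow> q h u" if "u \<in> X" "(h, u) \<in> T" for u
    using leaf that unfolding b_def by metis
  have "\<forall>u\<in>X. \<forall>v\<in>X. (u, v) \<in> T \<longrightarrow> ((p(h := b)) u = (p(h := b)) v \<longleftrightarrow> q u v)"
  proof (intro ballI impI)
    fix u v assume uv: "u \<in> X" "v \<in> X" "(u, v) \<in> T"
    then have "(v, u) \<in> T" "u \<noteq> v" using T' by (auto simp: sym_def irrefl_def)
    then show "(p(h := b)) u = (p(h := b)) v \<longleftrightarrow> q u v"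
      using uv p b[of u] b[of v] q[of u v] by (cases "u = h"; cases "v = h") auto
  qed
  then show ?case by blast
qed

lemma forest_rel_no_triangle:
  assumes "forest_rel T" "(a, b) \<in> T" "(b, c) \<in> T"
  shows "(c, a) \<notin> T"
proof (cases "distinct [a, b, c]")
  case True
  then show ?thesis
    using assms[unfolded forest_rel_def] by (auto dest!: spec[of _ "[a, b, c]"])
qed (use assms in \<open>auto simp: forest_rel_def irrefl_def\<close>)

lemma forest_rel_no_quadrangle:
  assumes "forest_rel T" "(a, b) \<in> T" "(b, c) \<in> T" "(c, d) \<in> T" "a \<noteq> c" "b \<noteq> d"
  shows "(d, a) \<notin> T"
proof (cases "distinct [a, b, c, d]")
  case True
  then show ?thesis
    using assms[unfolded forest_rel_def] by (auto dest!: spec[of _ "[a, b, c, d]"])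
qed (use assms in \<open>auto simp: forest_rel_def irrefl_def\<close>)

lemma forest_rel_no_pentagon:
  assumes "forest_rel T" "(a, b) \<in> T" "(b, c) \<in> T" "(c, d) \<in> T" "(d, e) \<in> T"
    and "distinct [a, b, c, d, e]"
  shows "(e, a) \<notin> T"
  using assms[unfolded forest_rel_def] by (auto dest!: spec[of _ "[a, b, c, d, e]"])

section \<open>From cycles of a tree to the forest relation\<close>

text \<open>Walks are lists of arcs; zipping a vertex list with its tail produces its consecutive
  pairs.\<close>

lemma (in pair_wf_digraph) awalk_zip_successively:
  assumes "successively (\<lambda>x y. (x, y) \<in> parcs G) (v # vs)" "v \<in> pverts G"
  shows "awalk v (zip (v # vs) vs) (last (v # vs))" "pawalk_verts v (zip (v # vs) vs) = v # vs"
  using assms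
proof (induction vs arbitrary: v)
  case (Cons w ws)
  case 1
  then show ?case using Cons(1)[of w] in_arcsD2[of v w] by (auto simp: awalk_Cons_iff)
next
  case (Cons w ws)
  case 2
  then show ?case using Cons(2)[of w] in_arcsD2[of v w] by auto
qed (auto simp: awalk_Nil_iff)

lemma undirected_tree_forest_rel:
  assumes "undirected_tree T"
  shows "forest_rel (parcs T)"
proof -
  interpret pair_graph T using assms by (simp add: undirected_tree_def)
  have "(last vs, hd vs) \<notin> parcs T"
    if vs: "distinct vs" "3 \<le> length vs" "successively (\<lambda>x y. (x, y) \<in> parcs T) vs" for vs
  proof
    assume e: "(last vs, hd vs) \<in> parcs T"
    \<comment> \<open>The closed walk starts at \<open>last vs\<close>: prefixing this vertex adds
      the closing arc, and the arc list becomes as long as \<open>vs\<close>.\<close>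
    have succ: "successively (\<lambda>x y. (x, y) \<in> parcs T) (last vs # vs)"
      using vs e by (cases vs) auto
    have "awalk (last vs) (zip (last vs # vs) vs) (last (last vs # vs))"
      and verts: "pawalk_verts (last vs) (zip (last vs # vs) vs) = last vs # vs"
      using awalk_zip_successively[OF succ in_arcsD1[OF e]] by auto
    moreover have "vs \<noteq> []" "length (zip (last vs # vs) vs) = length vs" using vs by auto
    ultimately have "cycle (zip (last vs # vs) vs)"
      unfolding cycle_def using vs(1) by (intro exI[of _ "last vs"]) auto
    then show False
      using assms vs(2) \<open>length (zip (last vs # vs) vs) = length vs\<close>
      unfolding undirected_tree_def by metis
  qed
  moreover have "sym (parcs T)" using arcs_symmetric by (auto intro: symI)
  moreover have "irrefl (parcs T)" using no_loops' by (auto simp: irrefl_def)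
  ultimately show ?thesis unfolding forest_rel_def by blast
qed

text \<open>\<open>d\<close> and \<open>e\<close> lie within distance one of \<open>b\<close> and
  \<open>c\<close>, on different branches at \<open>a\<close>. Equality or adjacency would close a
  cycle of length three to five.\<close>

lemma forest_rel_branches:
  assumes T: "forest_rel T" and "(a, b) \<in> T" "(a, c) \<in> T" "b \<noteq> c"
    and d: "d = b \<or> (b, d) \<in> T" "d \<noteq> a" and e: "e = c \<or> (c, e) \<in> T" "e \<noteq> a"
  shows "d \<noteq> e \<and> (d, e) \<notin> T"
proof -
  have sym: "(y, x) \<in> T" if "(x, y) \<in> T" for x y
    using T that by (auto simp: forest_rel_def sym_def)
  have irr: "(x, x) \<notin> T" for x
    using T by (auto simp: forest_rel_def irrefl_def)
  have bc: "(b, c) \<notin> T"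
    using forest_rel_no_triangle[OF T] assms sym by blast
  have quad: "\<not> ((b, x) \<in> T \<and> (x, c) \<in> T)" if "x \<noteq> a" for x
    using forest_rel_no_quadrangle[OF T, of a b x c] assms sym that by blast
  have "(d, e) \<notin> T" if "(b, d) \<in> T" "(c, e) \<in> T"
  proof (cases "distinct [a, b, d, e, c]")
    case True
    then show ?thesis
      using forest_rel_no_pentagon[OF T, of a b d e c] that assms sym by blast
  next
    case False
    then show ?thesis using that assms bc sym irr by auto
  qed
  then show ?thesis
    using d e quad[of d] quad[of e] bc sym irr \<open>b \<noteq> c\<close> by metis
qed

section \<open>Constructing the orientation\<close>

text \<open>The parts are the fibres of \<open>bag\<close>, so that \<open>T\<close> may be any forest containing all pairs of
  adjacent parts.\<close>
locale bag_forest = pair_graph G for G :: "'a pair_pre_digraph" +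
  fixes bag :: "'a \<Rightarrow> 'b" and T :: "'b rel"
  assumes forest: "forest_rel T"
    and bag_clique: "u \<in> pverts G \<Longrightarrow> v \<in> pverts G \<Longrightarrow> bag u = bag v \<Longrightarrow> u \<noteq> v \<Longrightarrow> (u, v) \<in> parcs G"
    and bag_complete: "(a, b) \<in> parcs G \<Longrightarrow> (a', b') \<in> parcs G \<Longrightarrow> bag a = bag a' \<Longrightarrow> bag b = bag b' \<Longrightarrow>
      bag a \<noteq> bag b \<Longrightarrow> (a, b') \<in> parcs G"
    and bag_arc: "(a, b) \<in> parcs G \<Longrightarrow> bag a \<noteq> bag b \<Longrightarrow> (bag a, bag b) \<in> T"
begin

abbreviation "V \<equiv> pverts G"
abbreviation "E \<equiv> parcs G"

text \<open>The closed neighbourhood. As bags are cliques, those of two vertices of one bag differ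
  only outside it, so inclusion compares outer neighbours.\<close>

definition nb :: "'a \<Rightarrow> 'a set" where
  "nb u = insert u (E `` {u})"

text \<open>A soft bag is a module whose outer neighbours lie in a single bag. Its vertices may be both
  above and below outer neighbours in a transitive orientation.\<close>
definition soft :: "'b \<Rightarrow> bool" where
  "soft \<beta> \<longleftrightarrow> (\<exists>\<alpha> S. \<alpha> \<noteq> \<beta> \<and> (\<forall>b\<in>V. bag b = \<beta> \<longrightarrow> {v. (b, v) \<in> E \<and> bag v \<noteq> \<beta>} = S) \<and>
     (\<forall>v\<in>S. bag v = \<alpha>))"

lemma E_commute: "(u, v) \<in> E \<longleftrightarrow> (v, u) \<in> E"
  using arcs_symmetric by blast

lemma bag_complete':
  assumes "(b, a) \<in> E" "(b', a') \<in> E" "bag a = bag a'" "bag b = bag b'" "bag a \<noteq> bag b"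
  shows "(b', a) \<in> E"
  using bag_complete[of a b a' b'] assms E_commute by blast

text \<open>If \<open>v\<close> and \<open>w\<close> shared a bag, completeness between bags would
  make \<open>x\<close> adjacent to \<open>w\<close>. So they lie on different branches of the
  forest at the bag of \<open>x\<close>.\<close>

lemma outer_nonadj:
  assumes "(x, v) \<in> E" "(y, w) \<in> E" "bag x = bag y" "bag v \<noteq> bag x" "bag w \<noteq> bag x" "(x, w) \<notin> E"
  shows "bag v \<noteq> bag w" "(v, w) \<notin> E"
proof -
  show ne: "bag v \<noteq> bag w"
    using bag_complete[of x v y w] assms by auto
  have "(bag x, bag v) \<in> T" "(bag x, bag w) \<in> T"
    using bag_arc[OF assms(1)] bag_arc[OF assms(2)] assms by auto
  then have "(bag v, bag w) \<notin> T"
    using forest_rel_branches[OF forest _ _ ne] assms by blast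
  then show "(v, w) \<notin> E" using bag_arc ne by blast
qed

lemma nb_diff:
  assumes "a \<in> V" "a' \<in> V" "bag a = bag a'" "\<not> nb a \<subseteq> nb a'"
  obtains v where "(a, v) \<in> E" "(a', v) \<notin> E" "bag v \<noteq> bag a"
proof -
  obtain v where v: "v \<in> nb a" "v \<notin> nb a'" using assms by blast
  have "a \<in> nb a'"
    using bag_clique[of a' a] assms by (auto simp: nb_def)
  with v have "(a, v) \<in> E" "(a', v) \<notin> E" "v \<noteq> a'" by (auto simp: nb_def)
  moreover from this have "bag v \<noteq> bag a"
    using bag_clique[of a' v] assms in_arcsD2 by auto
  ultimately show ?thesis using that by blast
qed

section \<open>Neighbourhoods within a bag have width at most two\<close>

text \<open>The bag supplies the triangle, and \<open>outer_nonadj\<close> separates the pendants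
  \<open>p\<close>, \<open>q\<close>, \<open>r\<close>.\<close>

lemma W1_of_private_neighbours:
  assumes "x \<in> V" "y \<in> V" "z \<in> V" "bag x = \<alpha>" "bag y = \<alpha>" "bag z = \<alpha>" "distinct [x, y, z]"
    and p: "bag p \<noteq> \<alpha>" "(x, p) \<in> E" "(y, p) \<notin> E" "(z, p) \<notin> E"
    and q: "bag q \<noteq> \<alpha>" "(y, q) \<in> E" "(x, q) \<notin> E" "(z, q) \<notin> E"
    and r: "bag r \<noteq> \<alpha>" "(z, r) \<in> E" "(x, r) \<notin> E" "(y, r) \<notin> E"
  shows "contains_induced G W1"
proof -
  have "(x, y) \<in> E" "(x, z) \<in> E" "(y, z) \<in> E"
    using bag_clique assms(1-7) by auto
  moreover have "(p, q) \<notin> E" "(p, r) \<notin> E" "(q, r) \<notin> E"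
    using outer_nonadj(2)[of x p y q]
      outer_nonadj(2)[of x p z r]
      outer_nonadj(2)[of y q z r] assms by auto
  ultimately show ?thesis
    using assms by (intro contains_W1I[of p x q y z r]) (simp_all add: E_commute)
qed

text \<open>Each outer vertex misses a different corner of the triangle, so
  \<open>outer_nonadj\<close> separates them.\<close>

lemma W2_of_shared_neighbours:
  assumes "x \<in> V" "y \<in> V" "z \<in> V" "bag x = \<alpha>" "bag y = \<alpha>" "bag z = \<alpha>" "distinct [x, y, z]"
    and p: "bag p \<noteq> \<alpha>" "(x, p) \<in> E" "(y, p) \<in> E" "(z, p) \<notin> E"
    and q: "bag q \<noteq> \<alpha>" "(x, q) \<in> E" "(z, q) \<in> E" "(y, q) \<notin> E"
    and r: "bag r \<noteq> \<alpha>" "(y, r) \<in> E" "(z, r) \<in> E" "(x, r) \<notin> E"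
  shows "contains_induced G W2"
proof -
  have "(x, y) \<in> E" "(x, z) \<in> E" "(y, z) \<in> E"
    using bag_clique assms(1-7) by auto
  moreover have "(p, q) \<notin> E" "(p, r) \<notin> E" "(q, r) \<notin> E"
    using outer_nonadj(2)[of y p x q]
      outer_nonadj(2)[of x p y r]
      outer_nonadj(2)[of x q y r] assms by auto
  ultimately show ?thesis
    using assms by (intro contains_W2I[of p x q y z r]) (simp_all add: E_commute)
qed

text \<open>Vertex 5 of \<open>W3\<close> is \<open>x\<close>, which has no pendant;
  \<open>r\<close> and \<open>s\<close> link its triangle edges instead.\<close>

lemma W3_of_mixed_neighbours:
  assumes "x \<in> V" "y \<in> V" "z \<in> V" "bag x = \<alpha>" "bag y = \<alpha>" "bag z = \<alpha>" "distinct [x, y, z]"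
    and p: "bag p \<noteq> \<alpha>" "(y, p) \<in> E" "(x, p) \<notin> E" "(z, p) \<notin> E"
    and q: "bag q \<noteq> \<alpha>" "(z, q) \<in> E" "(x, q) \<notin> E" "(y, q) \<notin> E"
    and r: "bag r \<noteq> \<alpha>" "(x, r) \<in> E" "(y, r) \<in> E" "(z, r) \<notin> E"
    and s: "bag s \<noteq> \<alpha>" "(x, s) \<in> E" "(z, s) \<in> E" "(y, s) \<notin> E"
  shows "contains_induced G W3"
proof -
  have "(x, y) \<in> E" "(x, z) \<in> E" "(y, z) \<in> E"
    using bag_clique assms(1-7) by auto
  moreover have "(p, q) \<notin> E" "(q, r) \<notin> E" "(p, s) \<notin> E" "(q, r) \<notin> E" "(s, q) \<notin> E" "(r, p) \<notin> E" "(r, s) \<notin> E"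
    using outer_nonadj(2)[of y p z q]
      outer_nonadj(2)[of z q x r]
      outer_nonadj(2)[of y p x s]
      outer_nonadj(2)[of z q y r]
      outer_nonadj(2)[of x s z q]
      outer_nonadj(2)[of x r y p]
      outer_nonadj(2)[of y r x s] assms by auto
  ultimately show ?thesis
    using assms by (intro contains_W3I[of p y q z x r s]) (simp_all add: E_commute)
qed

text \<open>In an antichain of three, each ordered pair supplies an outer neighbour of the first
  vertex missed by the second: either private (\<open>p\<close>) or shared with the third
  (\<open>q\<close>). If all three vertices have private ones, \<open>W1\<close> arises; if exactly
  two, \<open>W3\<close>; if at most one, each pair shares one and \<open>W2\<close> arises.\<close>

lemma bag_width_le_2:
  assumes noW: "\<not> contains_induced G W1" "\<not> contains_induced G W2" "\<not> contains_induced G W3"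
    and V: "x \<in> V" "y \<in> V" "z \<in> V" and bags: "bag x = \<alpha>" "bag y = \<alpha>" "bag z = \<alpha>"
  shows "comparable (nb x) (nb y) \<or> comparable (nb x) (nb z) \<or> comparable (nb y) (nb z)"
proof (rule ccontr)
  assume n: "\<not> ?thesis"
  then have dist: "distinct [x, y, z]" by (auto simp: comparable_def)
  define p where "p a b c \<longleftrightarrow> (\<exists>v. bag v \<noteq> \<alpha> \<and> (a, v) \<in> E \<and> (b, v) \<notin> E \<and> (c, v) \<notin> E)" for a b c
  define q where "q a b c \<longleftrightarrow> (\<exists>v. bag v \<noteq> \<alpha> \<and> (a, v) \<in> E \<and> (b, v) \<in> E \<and> (c, v) \<notin> E)" for a b c
  have pq: "p a b c \<or> q a c b" if "a \<in> V" "b \<in> V" "bag a = \<alpha>" "bag b = \<alpha>" "\<not> nb a \<subseteq> nb b" for a b c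
    using nb_diff[of a b] that unfolding p_def q_def by metis
  have qc: "q a b c \<longleftrightarrow> q b a c" and pc: "p a b c \<longleftrightarrow> p a c b" for a b c
    unfolding p_def q_def by auto
  have w1: "\<not> (p x y z \<and> p y x z \<and> p z x y)"
    using W1_of_private_neighbours[OF V bags dist] noW unfolding p_def by metis
  have w2: "\<not> (q x y z \<and> q x z y \<and> q y z x)"
    using W2_of_shared_neighbours[OF V bags dist] noW unfolding q_def by metis
  have w3: "\<not> (p b a c \<and> p c a b \<and> q a b c \<and> q a c b)"
    if "a \<in> V" "b \<in> V" "c \<in> V" "bag a = \<alpha>" "bag b = \<alpha>" "bag c = \<alpha>" "distinct [a, b, c]" for a b c
    using W3_of_mixed_neighbours[OF that] noW unfolding p_def q_def by metis
  have "p x y z \<or> q x z y" "p x z y \<or> q x y z" "p y x z \<or> q y z x"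
    "p y z x \<or> q y x z" "p z x y \<or> q z y x" "p z y x \<or> q z x y"
    using pq V bags n unfolding comparable_def by blast+
  moreover have "distinct [y, x, z]" "distinct [z, x, y]" using dist by auto
  ultimately show False
    using w1 w2 w3[OF V bags dist] w3[of y x z] w3[of z x y] V bags qc pc by metis
qed

section \<open>Attachment to bags that are not soft\<close>

text \<open>A bag that is not soft offers, near any neighbour \<open>a\<close>, an induced path
  \<open>a\<close>, \<open>b'\<close>, \<open>d\<close>; such \<open>d\<close> become the pendants
  in copies of \<open>W1\<close> and \<open>W4\<close>.\<close>

lemma rigid_pendant:
  assumes ab: "(a, b) \<in> E" "bag a \<noteq> bag b" and rigid: "\<not> soft (bag b)"
  obtains b' d where "bag b' = bag b" "(a, b') \<in> E" "(b', d) \<in> E" "bag d \<noteq> bag a"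
    "\<And>x. bag x = bag a \<Longrightarrow> (x, d) \<notin> E" "bag d = bag b \<or> (bag b, bag d) \<in> T"
proof (cases "\<exists>d\<in>V. bag d = bag b \<and> (a, d) \<notin> E")
  case True
  \<comment> \<open>By completeness, a vertex of this bag missed by \<open>a\<close> is missed by
    the whole bag of \<open>a\<close>.\<close>
  then obtain d where d: "d \<in> V" "bag d = bag b" "(a, d) \<notin> E" by auto
  have "b \<in> V" "b \<noteq> d" using ab d in_arcsD2 by auto
  then have "(b, d) \<in> E" using bag_clique[of b d] d by auto
  moreover have "(x, d) \<notin> E" if "bag x = bag a" for x
    using bag_complete[of a b x d] d ab that by auto
  ultimately show ?thesis using that[of b d] d ab by auto
next
  case False
  \<comment> \<open>Now \<open>a\<close> sees the whole bag of \<open>b\<close>, so all its vertices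
    have the same neighbours \<open>S\<close> in the bag of \<open>a\<close>. As the bag is not
    soft, some vertex of it has a neighbour in a third bag.\<close>
  define S where "S = {v. (b, v) \<in> E \<and> bag v = bag a}"
  have "\<not> (\<forall>b'\<in>V. bag b' = bag b \<longrightarrow> {v. (b', v) \<in> E \<and> bag v \<noteq> bag b} = S)"
    using rigid ab unfolding soft_def S_def by blast
  then obtain b' where b': "b' \<in> V" "bag b' = bag b" "{v. (b', v) \<in> E \<and> bag v \<noteq> bag b} \<noteq> S"
    by blast
  have ab': "(a, b') \<in> E" using False b' by blast
  have "S \<subseteq> {v. (b', v) \<in> E \<and> bag v \<noteq> bag b}"
    using bag_complete'[of b _ b' a] ab ab' b' E_commute unfolding S_def by auto
  then obtain d where d: "(b', d) \<in> E" "bag d \<noteq> bag b" "d \<notin> S"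
    using b' by blast
  have da: "bag d \<noteq> bag a"
    using bag_complete'[of b' d b a] d ab b' E_commute unfolding S_def by auto
  have T: "(bag b, bag d) \<in> T" "(bag a, bag b) \<in> T"
    using bag_arc d ab b' by metis+
  have "(x, d) \<notin> E" if "bag x = bag a" for x
    using forest_rel_no_triangle[OF forest T(2,1)] bag_arc[of d x] E_commute da that by auto
  then show ?thesis using that[of b' d] b' ab' d da T by blast
qed

lemma branch_nonadj:
  assumes "(x, b) \<in> E" "(y, c) \<in> E" "bag x = \<alpha>" "bag y = \<alpha>" "bag b \<noteq> \<alpha>" "bag c \<noteq> \<alpha>" "bag b \<noteq> bag c"
    "bag d \<noteq> \<alpha>" "bag d = bag b \<or> (bag b, bag d) \<in> T"
    "bag e \<noteq> \<alpha>" "bag e = bag c \<or> (bag c, bag e) \<in> T"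
  shows "(d, e) \<notin> E"
proof -
  have "(\<alpha>, bag b) \<in> T" "(\<alpha>, bag c) \<in> T"
    using bag_arc[OF assms(1)] bag_arc[OF assms(2)] assms by auto
  then have "bag d \<noteq> bag e \<and> (bag d, bag e) \<notin> T"
    using forest_rel_branches[OF forest] assms by blast
  then show ?thesis using bag_arc by blast
qed

text \<open>If \<open>x\<close> and \<open>y\<close> were incomparable, each would have an outer
  neighbour missed by the other. These and \<open>d\<close> would be pendants at the triangle
  \<open>x\<close>, \<open>y\<close>, \<open>b'\<close>, forming \<open>W1\<close>.\<close>

lemma rigid_chain:
  assumes noW: "\<not> contains_induced G W1"
    and bags: "bag x = \<alpha>" "bag y = \<alpha>" "bag b \<noteq> \<alpha>" and rigid: "\<not> soft (bag b)"
    and xb: "(x, b) \<in> E" and yb: "(y, b) \<in> E"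
  shows "comparable (nb x) (nb y)"
proof (rule ccontr)
  assume n: "\<not> ?thesis"
  have V: "x \<in> V" "y \<in> V" using xb yb in_arcsD1 by auto
  obtain u where u: "(x, u) \<in> E" "(y, u) \<notin> E" "bag u \<noteq> \<alpha>"
    using nb_diff[of x y] n V bags by (auto simp: comparable_def)
  obtain w where w: "(y, w) \<in> E" "(x, w) \<notin> E" "bag w \<noteq> \<alpha>"
    using nb_diff[of y x] n V bags by (auto simp: comparable_def)
  obtain b' d where b': "bag b' = bag b" "(x, b') \<in> E" "(b', d) \<in> E" "bag d \<noteq> \<alpha>"
    and d: "\<And>v. bag v = \<alpha> \<Longrightarrow> (v, d) \<notin> E" "bag d = bag b' \<or> (bag b', bag d) \<in> T"
    using rigid_pendant[OF xb _ rigid] bags by metis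
  have yb': "(y, b') \<in> E" using bag_complete[of y b x b'] yb b' bags by auto
  have ub: "bag b' \<noteq> bag u" "(b', u) \<notin> E"
    using outer_nonadj[of y b' x u] yb' u b' bags by auto
  have wb: "bag b' \<noteq> bag w" "(b', w) \<notin> E"
    using outer_nonadj[of x b' y w] w b' bags by auto
  have uw: "(u, w) \<notin> E" using outer_nonadj[of x u y w] u w bags by auto
  have "(d, u) \<notin> E" using branch_nonadj[of x b' x u \<alpha> d u] b' u ub d bags by auto
  moreover have "(d, w) \<notin> E" using branch_nonadj[of x b' y w \<alpha> d w] b' w wb d bags by auto
  moreover have "x \<noteq> y" using u by auto
  then have "(x, y) \<in> E" using bag_clique V bags by auto
  ultimately have "contains_induced G W1"
    using u w b' yb' ub wb uw d(1)[of x] d(1)[of y] bags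
    by (intro contains_W1I[of u x w y b' d]) (simp_all add: E_commute)
  with noW show False ..
qed

text \<open>This excludes properly overlapping attachment sets: \<open>b'\<close> and
  \<open>c'\<close> sit on the sides \<open>xy\<close> and \<open>xz\<close> of a triangle, and
  their pendants \<open>d\<close> and \<open>e\<close> complete \<open>W4\<close>.\<close>

lemma rigid_laminar:
  assumes noW: "\<not> contains_induced G W4"
    and bags: "bag x = \<alpha>" "bag y = \<alpha>" "bag z = \<alpha>" "bag b \<noteq> \<alpha>" "bag c \<noteq> \<alpha>"
    and rigid: "\<not> soft (bag b)" "\<not> soft (bag c)"
    and x: "(x, b) \<in> E" "(x, c) \<in> E" and y: "(y, b) \<in> E" "(y, c) \<notin> E"
    and z: "(z, b) \<notin> E" "(z, c) \<in> E"
  shows False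
proof -
  have bc: "bag b \<noteq> bag c" using outer_nonadj[of y b x c] x y bags by auto
  obtain b' d where b': "bag b' = bag b" "(x, b') \<in> E" "(b', d) \<in> E" "bag d \<noteq> \<alpha>"
    and d: "\<And>v. bag v = \<alpha> \<Longrightarrow> (v, d) \<notin> E" "bag d = bag b' \<or> (bag b', bag d) \<in> T"
    using rigid_pendant[OF x(1) _ rigid(1)] bags by metis
  obtain c' e where c': "bag c' = bag c" "(x, c') \<in> E" "(c', e) \<in> E" "bag e \<noteq> \<alpha>"
    and e: "\<And>v. bag v = \<alpha> \<Longrightarrow> (v, e) \<notin> E" "bag e = bag c' \<or> (bag c', bag e) \<in> T"
    using rigid_pendant[OF x(2) _ rigid(2)] bags by metis
  have yz: "(y, b') \<in> E" "(z, c') \<in> E" "(y, c') \<notin> E" "(z, b') \<notin> E"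
    using bag_complete[of y b x b'] bag_complete[of z c x c'] bag_complete[of y c' x c]
      bag_complete[of z b' x b] x y z b' c' bags by auto
  have "(p, q) \<notin> E" if "p = b' \<or> p = d" "q = c' \<or> q = e" for p q
    using branch_nonadj[of x b' x c' \<alpha> p q] that b' c' d e bags bc by auto
  then have "(b', c') \<notin> E" "(b', e) \<notin> E" "(c', d) \<notin> E" "(d, e) \<notin> E"
    using E_commute by auto
  moreover have "(x, y) \<in> E" "(x, z) \<in> E" "(y, z) \<in> E"
    using bag_clique x y z bags in_arcsD1 by metis+
  ultimately have "contains_induced G W4"
    using b' c' yz d(1)[of x] d(1)[of y] d(1)[of z] e(1)[of x] e(1)[of y] e(1)[of z] bags
    by (intro contains_W4I[of x y z b' c' d e]) (simp_all add: E_commute)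
  with noW show False ..
qed

text \<open>In each bag \<open>two_chain_cover_laminar\<close> is applied to the attachment sets of
  outer vertices whose bags are not soft; \<open>rigid_chain\<close> and
  \<open>rigid_laminar\<close> provide its hypotheses on them.\<close>

lemma bag_colouring:
  assumes noW: "\<not> contains_induced G W1" "\<not> contains_induced G W2"
      "\<not> contains_induced G W3" "\<not> contains_induced G W4"
  obtains c :: "'a \<Rightarrow> bool"
  where "\<forall>x\<in>V. \<forall>y\<in>V. bag x = bag y \<longrightarrow> c x = c y \<longrightarrow> comparable (nb x) (nb y)"
    and "\<forall>x y b. bag x = bag y \<longrightarrow> bag b \<noteq> bag x \<longrightarrow> \<not> soft (bag b) \<longrightarrow>
      (x, b) \<in> E \<longrightarrow> (y, b) \<in> E \<longrightarrow> c x = c y"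
proof -
  define good where "good \<alpha> c \<longleftrightarrow> (\<forall>x y. x \<in> V \<longrightarrow> y \<in> V \<longrightarrow> bag x = \<alpha> \<longrightarrow> bag y = \<alpha> \<longrightarrow> c x = c y \<longrightarrow>
        comparable (nb x) (nb y)) \<and>
      (\<forall>x y b. bag x = \<alpha> \<longrightarrow> bag y = \<alpha> \<longrightarrow> bag b \<noteq> \<alpha> \<longrightarrow> \<not> soft (bag b) \<longrightarrow>
        (x, b) \<in> E \<longrightarrow> (y, b) \<in> E \<longrightarrow> c x = c y)"
    for \<alpha> and c :: "'a \<Rightarrow> bool"
  have "\<exists>c. good \<alpha> c" for \<alpha>
  proof -
    let ?X = "{a \<in> V. bag a = \<alpha>}"
    let ?S = "\<lambda>b. {a \<in> ?X. (a, b) \<in> E}"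
    let ?F = "{?S b |b. bag b \<noteq> \<alpha> \<and> \<not> soft (bag b)}"
    obtain c :: "'a \<Rightarrow> bool"
      where c1: "\<And>x y. x \<in> ?X \<Longrightarrow> y \<in> ?X \<Longrightarrow> c x = c y \<Longrightarrow> comparable (nb x) (nb y)"
        and c2: "\<And>S x y. S \<in> ?F \<Longrightarrow> x \<in> S \<Longrightarrow> y \<in> S \<Longrightarrow> c x = c y"
    proof (rule two_chain_cover_laminar[of ?X nb ?F])
      show "finite ?X" by simp
    next
      fix x y z assume "x \<in> ?X" "y \<in> ?X" "z \<in> ?X"
      then show "comparable (nb x) (nb y) \<or> comparable (nb x) (nb z) \<or> comparable (nb y) (nb z)"
        using bag_width_le_2[OF noW(1-3)] by blast
    next
      fix S S' assume "S \<in> ?F" "S' \<in> ?F"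
      then obtain b b' where b: "S = ?S b" "bag b \<noteq> \<alpha>" "\<not> soft (bag b)"
        and b': "S' = ?S b'" "bag b' \<noteq> \<alpha>" "\<not> soft (bag b')"
        by blast
      show "S \<subseteq> S' \<or> S' \<subseteq> S \<or> S \<inter> S' = {}"
      proof (rule ccontr)
        assume "\<not> ?thesis"
        then obtain x y z where "x \<in> S \<inter> S'" "y \<in> S - S'" "z \<in> S' - S" by blast
        then show False
          using rigid_laminar[OF noW(4), of x \<alpha> y z b b'] b b' by auto
      qed
    next
      fix S x y assume "S \<in> ?F" "x \<in> S" "y \<in> S"
      then show "comparable (nb x) (nb y)"
        using rigid_chain[OF noW(1), of x \<alpha> y] by auto
    next
      \<comment> \<open>The outer vertex defining \<open>S\<close> lies in \<open>nb x\<close>,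
        hence in \<open>nb y\<close>, and differs from \<open>y\<close> by its bag.\<close>
      fix S x y assume "S \<in> ?F" "x \<in> S" "y \<in> ?X" "nb x \<subseteq> nb y"
      then show "y \<in> S" by (auto simp: nb_def)
    qed auto
    show ?thesis unfolding good_def
    proof (intro exI[of _ c] conjI allI impI)
      fix x y assume "x \<in> V" "y \<in> V" "bag x = \<alpha>" "bag y = \<alpha>" "c x = c y"
      then show "comparable (nb x) (nb y)" using c1 by simp
    next
      fix x y b
      assume *: "bag x = \<alpha>" "bag y = \<alpha>" "bag b \<noteq> \<alpha>" "\<not> soft (bag b)" "(x, b) \<in> E" "(y, b) \<in> E"
      then have "x \<in> ?S b" "y \<in> ?S b" using in_arcsD1 by auto
      moreover have "?S b \<in> ?F" using * by blast
      ultimately show "c x = c y" using c2 by blast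
    qed
  qed
  then obtain c where c: "good \<alpha> (c \<alpha>)" for \<alpha>
    by metis
  show ?thesis
  proof (rule that[of "\<lambda>x. c (bag x) x"]; intro ballI allI impI)
    fix x y assume "x \<in> V" "y \<in> V" "bag x = bag y" "c (bag x) x = c (bag y) y"
    then show "comparable (nb x) (nb y)" using c[of "bag x"] by (simp add: good_def)
  next
    fix x y b
    assume *: "bag x = bag y" "bag b \<noteq> bag x" "\<not> soft (bag b)" "(x, b) \<in> E" "(y, b) \<in> E"
    have "c (bag x) x = c (bag x) y"
      by (rule c[of "bag x", unfolded good_def, THEN conjunct2, rule_format,
            OF refl *(1)[symmetric] *(2-5)])
    also have "\<dots> = c (bag y) y" by (rule arg_cong[OF *(1)])
    finally show "c (bag x) x = c (bag y) y" .
  qed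
qed

section \<open>Soft bags and the choice of signs\<close>

lemma soft_nb_eq:
  assumes "soft (bag u)" "u \<in> V" "v \<in> V" "bag u = bag v"
  shows "nb u = nb v"
proof -
  obtain S where S: "\<forall>b\<in>V. bag b = bag u \<longrightarrow> {w. (b, w) \<in> E \<and> bag w \<noteq> bag u} = S"
    using assms(1) unfolding soft_def by blast
  note S[rule_format, OF assms(2) refl] S[rule_format, OF assms(3) assms(4)[symmetric]]
  then have "(u, w) \<in> E \<longleftrightarrow> (v, w) \<in> E" if "bag w \<noteq> bag u" for w
    using that by blast
  moreover have "w \<in> nb u \<and> w \<in> nb v" if "bag w = bag u" "w \<in> V" for w
    using bag_clique[of u w] bag_clique[of v w] that assms by (auto simp: nb_def)
  ultimately have "w \<in> nb u \<longleftrightarrow> w \<in> nb v" for w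
    using assms in_arcsD2 by (cases "bag w = bag u") (auto simp: nb_def)
  then show ?thesis by blast
qed

lemma soft_outer_unique:
  assumes "soft (bag u)" "bag u = bag u'" "(u, v) \<in> E" "(u', v') \<in> E" "bag v \<noteq> bag u" "bag v' \<noteq> bag u"
  shows "bag v = bag v'"
proof -
  obtain \<alpha> S where S: "\<forall>b\<in>V. bag b = bag u \<longrightarrow> {v. (b, v) \<in> E \<and> bag v \<noteq> bag u} = S"
    and \<alpha>: "\<forall>v\<in>S. bag v = \<alpha>"
    using assms(1) unfolding soft_def by blast
  have "u \<in> V" "u' \<in> V" using assms in_arcsD1 by blast+
  then have "v \<in> S" "v' \<in> S" using S assms by auto
  then show ?thesis using \<alpha> by simp
qed

text \<open>Of two mutually adjacent soft bags exactly one is selected.\<close>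
lemma zero_bags:
  obtains zero :: "'b \<Rightarrow> bool"
  where "\<forall>\<beta>. zero \<beta> \<longrightarrow> soft \<beta>"
    and "\<forall>a b. (a, b) \<in> E \<longrightarrow> bag a \<noteq> bag b \<longrightarrow> zero (bag a) \<longrightarrow> \<not> zero (bag b)"
    and "\<forall>a b. (a, b) \<in> E \<longrightarrow> bag a \<noteq> bag b \<longrightarrow> \<not> zero (bag a) \<longrightarrow> \<not> zero (bag b) \<longrightarrow> \<not> soft (bag b)"
proof -
  \<comment> \<open>The numbering breaks the tie between adjacent soft bags.\<close>
  obtain j :: "'b \<Rightarrow> nat" where j: "inj_on j (bag ` V)"
    using finite_imp_inj_to_nat_seg[of "bag ` V"] by auto
  define zero where "zero \<beta> \<longleftrightarrow> soft \<beta> \<and>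
    (\<forall>a b. (a, b) \<in> E \<and> bag a = \<beta> \<and> bag b \<noteq> \<beta> \<and> soft (bag b) \<longrightarrow> j \<beta> < j (bag b))" for \<beta>
  \<comment> \<open>A soft bag that is not selected has an adjacent soft bag of no larger index,
    which must be its only neighbouring bag.\<close>
  have less: "soft (bag a) \<and> j (bag a) \<le> j (bag b)"
    if ab: "(a, b) \<in> E" "bag a \<noteq> bag b" "soft (bag b)" "\<not> zero (bag b)" for a b
  proof -
    obtain u v where uv: "(u, v) \<in> E" "bag u = bag b" "bag v \<noteq> bag b" "soft (bag v)"
        "j (bag v) \<le> j (bag b)"
      using ab unfolding zero_def by (auto simp: not_less)
    have "bag a = bag v"
      by (rule soft_outer_unique[OF ab(3) uv(2)[symmetric] arcs_symmetric[OF ab(1)] uv(1) ab(2) uv(3)])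
    with uv show ?thesis by simp
  qed
  show ?thesis
  proof (rule that[of zero]; intro allI impI)
    fix a b assume ab: "(a, b) \<in> E" "bag a \<noteq> bag b"
    show "\<not> zero (bag b)" if "zero (bag a)"
    proof
      assume "zero (bag b)"
      then have "j (bag a) < j (bag b)" "j (bag b) < j (bag a)"
        using that ab arcs_symmetric[OF ab(1)] unfolding zero_def by metis+
      then show False by simp
    qed
    show "\<not> soft (bag b)" if nz: "\<not> zero (bag a)" "\<not> zero (bag b)"
    proof
      assume "soft (bag b)"
      then have a: "soft (bag a)" "j (bag a) \<le> j (bag b)"
        using less[OF ab] nz by auto
      moreover have "j (bag b) \<le> j (bag a)"
        using less[of b a] arcs_symmetric[OF ab(1)] ab nz a by auto
      ultimately show False
        using j ab in_arcsD1[OF ab(1)] in_arcsD2[OF ab(1)] by (auto dest: inj_onD)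
    qed
  qed (simp add: zero_def)
qed

text \<open>Selected bags get sign 0 and are never adjacent. Elsewhere the sign is the colour,
  flipped bag by bag through \<open>p\<close>.\<close>

lemma sign_function:
  assumes noW: "\<not> contains_induced G W1" "\<not> contains_induced G W2"
      "\<not> contains_induced G W3" "\<not> contains_induced G W4"
  obtains \<sigma> :: "'a \<Rightarrow> int"
  where "\<forall>v. \<sigma> v \<in> {-1, 0, 1}"
    and "\<forall>a b. (a, b) \<in> E \<longrightarrow> bag a \<noteq> bag b \<longrightarrow> \<sigma> a \<noteq> \<sigma> b"
    and "\<forall>v. \<sigma> v = 0 \<longrightarrow> soft (bag v)"
    and "\<forall>u\<in>V. \<forall>v\<in>V. bag u = bag v \<longrightarrow> \<sigma> u = \<sigma> v \<longrightarrow> comparable (nb u) (nb v)"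
proof -
  obtain c :: "'a \<Rightarrow> bool"
    where "\<forall>x\<in>V. \<forall>y\<in>V. bag x = bag y \<longrightarrow> c x = c y \<longrightarrow> comparable (nb x) (nb y)"
      and "\<forall>x y b. bag x = bag y \<longrightarrow> bag b \<noteq> bag x \<longrightarrow> \<not> soft (bag b) \<longrightarrow>
        (x, b) \<in> E \<longrightarrow> (y, b) \<in> E \<longrightarrow> c x = c y"
    using bag_colouring[OF noW] .
  note c1 = this(1)[rule_format] and c2 = this(2)[rule_format]
  obtain zero where "\<forall>\<beta>. zero \<beta> \<longrightarrow> soft \<beta>"
    and "\<forall>a b. (a, b) \<in> E \<longrightarrow> bag a \<noteq> bag b \<longrightarrow> zero (bag a) \<longrightarrow> \<not> zero (bag b)"
    and "\<forall>a b. (a, b) \<in> E \<longrightarrow> bag a \<noteq> bag b \<longrightarrow> \<not> zero (bag a) \<longrightarrow> \<not> zero (bag b) \<longrightarrow>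
      \<not> soft (bag b)"
    using zero_bags .
  note z1 = this(1)[rule_format] and z2 = this(2)[rule_format] and z3 = this(3)[rule_format]
  \<comment> \<open>Signs are opposite across an edge iff both bags flip alike exactly when the
    colours of its ends differ; \<open>q\<close> states this demand for
    \<open>forest_rel_potential\<close>.\<close>
  define q where "q \<alpha> \<beta> \<longleftrightarrow> (\<exists>a b. (a, b) \<in> E \<and> bag a = \<alpha> \<and> bag b = \<beta> \<and> c a \<noteq> c b)" for \<alpha> \<beta>
  have "q \<alpha> \<beta> \<longleftrightarrow> q \<beta> \<alpha>" for \<alpha> \<beta>
    using arcs_symmetric unfolding q_def by metis
  then obtain p :: "'b \<Rightarrow> bool"
    where p: "\<forall>\<alpha>\<in>bag ` V. \<forall>\<beta>\<in>bag ` V. (\<alpha>, \<beta>) \<in> T \<longrightarrow> (p \<alpha> = p \<beta> \<longleftrightarrow> q \<alpha> \<beta>)"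
    using forest_rel_potential[OF forest, of "bag ` V" q] by auto
  define \<sigma> :: "'a \<Rightarrow> int"
    where "\<sigma> v = (if zero (bag v) then 0 else if p (bag v) = c v then 1 else -1)" for v
  have opp: "(p (bag a) = c a) \<noteq> (p (bag b) = c b)"
    if ab: "(a, b) \<in> E" "bag a \<noteq> bag b" and nz: "\<not> zero (bag a)" "\<not> zero (bag b)" for a b
  proof -
    have ba: "(b, a) \<in> E" using ab(1) by (rule arcs_symmetric)
    have rigid: "\<not> soft (bag a)" "\<not> soft (bag b)"
      using z3[OF ab] z3[OF ba] ab(2) nz by auto
    \<comment> \<open>Neither bag is soft, so the attachment sets on both sides are monochromatic,
      and a single edge decides \<open>q\<close>.\<close>
    have unif: "c a = c a' \<and> c b = c b'" if "(a', b') \<in> E" "bag a' = bag a" "bag b' = bag b" for a' b'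
    proof
      have "(a', b) \<in> E" using bag_complete[of a' b' a b] that ab by auto
      then show "c a = c a'" using c2[of a a' b] that ab rigid by auto
      have "(b', a) \<in> E" using bag_complete[of a b a' b'] that ab E_commute by auto
      then show "c b = c b'" using c2[of b b' a] that ab ba rigid by auto
    qed
    have "q (bag a) (bag b) \<longleftrightarrow> c a \<noteq> c b"
      using unif ab(1) unfolding q_def by metis
    moreover have "p (bag a) = p (bag b) \<longleftrightarrow> q (bag a) (bag b)"
      using p bag_arc[OF ab] in_arcsD1[OF ab(1)] in_arcsD2[OF ab(1)] by blast
    ultimately show ?thesis by auto
  qed
  show ?thesis
  proof (rule that[of \<sigma>]; intro ballI allI impI)
    fix a b assume ab: "(a, b) \<in> E" "bag a \<noteq> bag b"
    show "\<sigma> a \<noteq> \<sigma> b"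
      using opp[OF ab] z2[OF ab] by (auto simp: \<sigma>_def)
  next
    fix u v assume uv: "u \<in> V" "v \<in> V" "bag u = bag v" "\<sigma> u = \<sigma> v"
    show "comparable (nb u) (nb v)"
    proof (cases "zero (bag u)")
      case True
      then show ?thesis using soft_nb_eq[of u v] z1 uv by (simp add: comparable_def)
    next
      case False
      then have "c u = c v" using uv by (auto simp: \<sigma>_def split: if_splits)
      then show ?thesis using c1 uv by blast
    qed
  qed (auto simp: \<sigma>_def z1 split: if_splits)
qed

section \<open>The orientation by signed weights\<close>

lemma transitive_orientation_exists:
  assumes noW: "\<not> contains_induced G W1" "\<not> contains_induced G W2"
      "\<not> contains_induced G W3" "\<not> contains_induced G W4"
  shows "\<exists>F. transitive_orientation G F"
proof -
  obtain \<sigma> :: "'a \<Rightarrow> int"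
    where rng: "\<forall>v. \<sigma> v \<in> {-1, 0, 1}"
    and cross: "\<forall>a b. (a, b) \<in> E \<longrightarrow> bag a \<noteq> bag b \<longrightarrow> \<sigma> a \<noteq> \<sigma> b"
    and soft: "\<forall>v. \<sigma> v = 0 \<longrightarrow> soft (bag v)"
    and chain: "\<forall>u\<in>V. \<forall>v\<in>V. bag u = bag v \<longrightarrow> \<sigma> u = \<sigma> v \<longrightarrow> comparable (nb u) (nb v)"
    using sign_function[OF noW] .
  note rng = rng[rule_format] and cross = cross[rule_format] and soft = soft[rule_format]
    and chain = chain[rule_format]
  obtain idx :: "'a \<Rightarrow> nat" where idx: "inj_on idx V"
    using finite_imp_inj_to_nat_seg[of V] by auto
  \<comment> \<open>The factor is positive, so decreasing \<open>w\<close> lists sign 1, then 0,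
    then -1. Larger neighbourhoods come first at sign 1 and last at sign -1.\<close>
  define w where "w v = \<sigma> v * (int (card (nb v)) + 1)" for v
  define less where "less u v \<longleftrightarrow> w u > w v \<or> w u = w v \<and> idx u < idx v" for u v
  define F where "F = {(u, v). (u, v) \<in> E \<and> less u v}"
  have fin: "finite (nb v)" for v
    unfolding nb_def by simp
  have w_mono: "\<sigma> v \<le> \<sigma> u" if "w v \<le> w u" for u v
    using that rng[of u] rng[of v] unfolding w_def by auto
  have less_w: "w v \<le> w u" if "less u v" for u v
    using that by (auto simp: less_def)
  have cross_less: "\<sigma> v < \<sigma> u" if "less u v" "(u, v) \<in> E" "bag u \<noteq> bag v" for u v
    using w_mono[OF less_w[OF that(1)]] cross[OF that(2,3)] by simp
  have nb_mono: "nb v \<subseteq> nb u"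
    if "u \<in> V" "v \<in> V" "bag u = bag v" "\<sigma> u = \<sigma> v" "card (nb v) \<le> card (nb u)" for u v
    using chain[OF that(1-4)] card_seteq[OF fin, of "nb u" v] that(5) unfolding comparable_def by blast
  have trans: "(x, z) \<in> E" if xy: "(x, y) \<in> E" "less x y" and yz: "(y, z) \<in> E" "less y z" for x y z
  proof -
    have V: "x \<in> V" "y \<in> V" "z \<in> V" using xy yz in_arcsD1 in_arcsD2 by blast+
    have le: "\<sigma> y \<le> \<sigma> x" "\<sigma> z \<le> \<sigma> y" using w_mono less_w xy yz by auto
    have "x \<noteq> z" using xy yz by (auto simp: less_def)
    consider "bag x = bag z" | "bag x = bag y" "bag y \<noteq> bag z" | "bag x \<noteq> bag y" "bag y = bag z"
      | "bag x \<noteq> bag y" "bag y \<noteq> bag z" "bag x \<noteq> bag z" by metis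
    then show ?thesis
    proof cases
      case 1
      then show ?thesis using bag_clique V \<open>x \<noteq> z\<close> by blast
    next
      case 2
      \<comment> \<open>The sign drops along the edge leaving the bag, so \<open>y\<close> has sign
        0 or 1. Either way the earlier vertex \<open>x\<close> inherits the neighbours of
        \<open>y\<close>, among them \<open>z\<close>.\<close>
      have "\<sigma> z < \<sigma> y" using cross_less yz 2 by blast
      then consider "\<sigma> y = 0" | "\<sigma> y = 1" using rng[of y] rng[of z] by auto
      then have "nb y \<subseteq> nb x"
      proof cases
        case 1
        then show ?thesis using soft_nb_eq[OF soft V(2,1) 2(1)[symmetric]] by blast
      next
        assume y: "\<sigma> y = 1"
        then have x: "\<sigma> x = 1" using le rng[of x] by auto
        then have "card (nb y) \<le> card (nb x)"
          using less_w[OF xy(2)] y by (simp add: w_def)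
        then show ?thesis using nb_mono[OF V(1,2) 2(1)] x y by simp
      qed
      then show ?thesis using yz \<open>x \<noteq> z\<close> by (auto simp: nb_def)
    next
      case 3
      \<comment> \<open>The mirror image: now \<open>y\<close> has sign 0 or -1, and the later
        vertex \<open>z\<close> inherits its neighbours, among them \<open>x\<close>.\<close>
      have "\<sigma> y < \<sigma> x" using cross_less xy 3 by blast
      then consider "\<sigma> y = 0" | "\<sigma> y = -1" using rng[of y] rng[of x] by auto
      then have "nb y \<subseteq> nb z"
      proof cases
        case 1
        then show ?thesis using soft_nb_eq[OF soft V(2,3) 3(2)] by blast
      next
        assume y: "\<sigma> y = -1"
        then have z: "\<sigma> z = -1" using le rng[of z] by auto
        then have "card (nb y) \<le> card (nb z)"
          using less_w[OF yz(2)] y by (simp add: w_def)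
        then show ?thesis using nb_mono[OF V(3,2) 3(2)[symmetric]] z y by simp
      qed
      then have "(z, x) \<in> E" using arcs_symmetric[OF xy(1)] \<open>x \<noteq> z\<close> by (auto simp: nb_def)
      then show ?thesis by (rule arcs_symmetric)
    next
      case 4
      \<comment> \<open>The signs must be 1, 0, -1, so the bag of \<open>y\<close> is soft; but its
        outer neighbours all lie in one bag.\<close>
      then have "\<sigma> z < \<sigma> y" "\<sigma> y < \<sigma> x" using cross_less xy yz by blast+
      then have "soft (bag y)" using rng[of x] rng[of y] rng[of z] soft[of y] by auto
      then have "bag x = bag z"
        using soft_outer_unique[OF _ refl arcs_symmetric[OF xy(1)] yz(1)] 4 by metis
      with 4 show ?thesis by simp
    qed
  qed
  have "less u v \<or> less v u" if "(u, v) \<in> E" for u v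
  proof -
    have "idx u \<noteq> idx v"
      using idx that in_arcsD1 in_arcsD2 no_loops'[OF that] by (metis inj_onD)
    then show ?thesis by (auto simp: less_def)
  qed
  then have "F \<union> F\<inverse> = E"
    using arcs_symmetric unfolding F_def by blast
  moreover have "F \<inter> F\<inverse> = {}"
    by (auto simp: F_def less_def)
  moreover have "trans F"
  proof (rule transI)
    fix x y z assume "(x, y) \<in> F" "(y, z) \<in> F"
    then show "(x, z) \<in> F"
      using trans[of x y z] by (auto simp: F_def less_def)
  qed
  ultimately show ?thesis unfolding transitive_orientation_def by blast
qed

end

section \<open>Application to well-partitioned chordal graphs\<close>

lemma well_partitioned_chordal_bag_forest:
  assumes "well_partitioned_chordal G"
  obtains bag :: "'a \<Rightarrow> 'a set" and T where "bag_forest G bag T"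
proof -
  interpret pair_graph G using assms by (simp add: well_partitioned_chordal_def)
  obtain P and T :: "'a set pair_pre_digraph" where P: "partition_on (pverts G) P"
    and T: "undirected_tree T"
    and cl: "\<And>A. A \<in> P \<Longrightarrow> clique G A"
    and comp: "\<And>A B. (A, B) \<in> parcs T \<Longrightarrow>
      \<exists>A' B'. A' \<subseteq> A \<and> B' \<subseteq> B \<and> parcs G \<inter> (A \<times> B) = A' \<times> B'"
    and non: "\<And>A B. A \<in> P \<Longrightarrow> B \<in> P \<Longrightarrow> A \<noteq> B \<Longrightarrow> (A, B) \<notin> parcs T \<Longrightarrow> parcs G \<inter> (A \<times> B) = {}"
    using assms unfolding well_partitioned_chordal_def by metis
  have "\<exists>A. A \<in> P \<and> v \<in> A" if "v \<in> pverts G" for v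
    using partition_onD1[OF P] that by blast
  then obtain bag where bag: "\<And>v. v \<in> pverts G \<Longrightarrow> bag v \<in> P \<and> v \<in> bag v"
    by metis
  have arc: "(bag a, bag b) \<in> parcs T" if "(a, b) \<in> parcs G" "bag a \<noteq> bag b" for a b
    using non[of "bag a" "bag b"] bag in_arcsD1[OF that(1)] in_arcsD2[OF that(1)] that by blast
  have "bag_forest G bag (parcs T)"
  proof unfold_locales
    show "forest_rel (parcs T)" using T by (rule undirected_tree_forest_rel)
  next
    fix u v assume "u \<in> pverts G" "v \<in> pverts G" "bag u = bag v" "u \<noteq> v"
    then show "(u, v) \<in> parcs G"
      using bag[of u] bag[of v] cl[of "bag u"] unfolding clique_def by metis
  next
    fix a b a' b'
    assume *: "(a, b) \<in> parcs G" "(a', b') \<in> parcs G" "bag a = bag a'" "bag b = bag b'" "bag a \<noteq> bag b"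
    obtain A' B' where AB: "parcs G \<inter> (bag a \<times> bag b) = A' \<times> B'"
      using comp[OF arc[OF *(1,5)]] by blast
    \<comment> \<open>A rectangle containing two arcs also contains the arc with mixed ends.\<close>
    have "(a, b) \<in> A' \<times> B'" "(a', b') \<in> A' \<times> B'"
      unfolding AB[symmetric]
      using * bag in_arcsD1[OF *(1)] in_arcsD2[OF *(1)] in_arcsD1[OF *(2)] in_arcsD2[OF *(2)] by auto
    then have "(a, b') \<in> parcs G \<inter> (bag a \<times> bag b)" unfolding AB by simp
    then show "(a, b') \<in> parcs G" by simp
  next
    fix a b assume "(a, b) \<in> parcs G" "bag a \<noteq> bag b"
    then show "(bag a, bag b) \<in> parcs T" by (rule arc)
  qed
  then show ?thesis by (rule that)
qed

theorem theorem5: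
  fixes G :: "'a pair_pre_digraph"
  assumes "well_partitioned_chordal G"
  shows "comparability_graph G \<longleftrightarrow>
    \<not> contains_induced G W1 \<and> \<not> contains_induced G W2 \<and>
    \<not> contains_induced G W3 \<and> \<not> contains_induced G W4"
proof
  assume "comparability_graph G"
  then show "\<not> contains_induced G W1 \<and> \<not> contains_induced G W2 \<and>
    \<not> contains_induced G W3 \<and> \<not> contains_induced G W4"
    using comparability_graph_no_W by blast
next
  assume noW: "\<not> contains_induced G W1 \<and> \<not> contains_induced G W2 \<and>
    \<not> contains_induced G W3 \<and> \<not> contains_induced G W4"
  obtain bag :: "'a \<Rightarrow> 'a set" and T where "bag_forest G bag T"
    using well_partitioned_chordal_bag_forest[OF assms] .
  then interpret bag_forest G bag T .
  show "comparability_graph G"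
    using transitive_orientation_exists noW pair_graph unfolding comparability_graph_def by blast
qed

end
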